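(* Let $h>0$, let $f\in C_0^+(\mathbb{R}^+)$, and assume that the $h$-trimming $\mathrm{Tr}^h(\mathcal{T}_f)$ is not empty. Then $\mathrm{Tr}^h(\mathcal{T}_f)$ (with the distance $d_f$ and root $\rho_f$) is equal, up to a root preserving isometry, to the rooted real tree generated inductively by the following algorithm. (Step 1) Start with a single branch of length $X_1(f)$, i.e. a segment $[\rho,z_1]$ of length $X_1(f)$, rooted at its endpoint $\rho$, with tip $z_1$. (Step $n$, $n\ge 2$) If $n>N_h(f)$, stop. Otherwise, with $z_{n-1}$ the tip of the $(n-1)$-th branch, graft on the ancestral line $[\rho,z_{n-1}]$ (the geodesic from the root to $z_{n-1}$ in the current tree), at the point at distance $Y_n(f)$ from $z_{n-1}$, a branch of length $X_n(f)$: i.e. glue a segment of length $X_n(f)$ by one of its endpoints to that point; the other endpoint of this segment is the tip $z_n$ of the $n$-th branch.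
   Context: $\mathbb{R}^+=[0,\infty)$, and $C_0^+(\mathbb{R}^+)$ is the set of continuous non-negative functions $f$ on $\mathbb{R}^+$ with $f(0)=0$ and compact support. Tree coded by a function. For $f\in C_0^+(\mathbb{R}^+)$ put $d_f(s,t)=f(s)+f(t)-2\inf_{[s\wedge t,s\vee t]}f$ and $s\sim t$ iff $d_f(s,t)=0$. The tree coded by $f$ is $\mathcal{T}_f=\mathbb{R}^+/\sim$ with the induced distance $d_f$; $p_f:\mathbb{R}^+\to\mathcal{T}_f$ is the canonical projection and $\rho_f=p_f(0)$ the root. The partial order is: $v'\preceq v$ iff $d_f(v,v')=d_f(\rho_f,v)-d_f(\rho_f,v')$. Trimming. $\mathrm{Tr}^h(\mathcal{T}_f)=\{x\in\mathcal{T}_f:\ \sup_{y\in\mathcal{T}_f,\ y\succeq x}d_f(x,y)\ge h\}$, rooted at $\rho_f$ when non-empty. Two-sided Skorohod reflection. For a continuous $f:\mathbb{R}^+\to\mathbb{R}$ with $f(0)\in[0,h]$, there is a unique pair of continuous functions $(c^0(f),c^h(f))$ on $\mathbb{R}^+$, both vanishing at $0$, such that: (a) $\Lambda_{0,h}(f):=f+c^0(f)+c^h(f)$ takes values in $[0,h]$; (b) $c^0(f)$ is non-decreasing and $c^h(f)$ is non-increasing; (c) the support of the measure $dc^0(f)$ (resp. $dc^h(f)$) is contained in $\{t:\Lambda_{0,h}(f)(t)=0\}$ (resp. $\{t:\Lambda_{0,h}(f)(t)=h\}$). $h$-cut. For continuous $f$ with $f(0)=0$, $f_h:=f-\Lambda_{0,h}(f)$.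 Times and lengths. For continuous $f$ with $f(0)=0$, set $t_0=0$ and, for $n\ge1$, $T_n=\inf\{u>t_{n-1}:\Lambda_{0,h}(f)(u)=h\}$, $t_n=\inf\{u>T_n:\Lambda_{0,h}(f)(u)=0\}$, $s_n=\sup\{u\in[t_{n-1},t_n):\Lambda_{0,h}(f)(u)=0\}$, with the convention $\inf\emptyset=\sup\emptyset=\infty$. Let $N_h(f)=\sup\{n:t_n<\infty\}$, and for $1\le n\le N_h(f)$ let $X_n(f)=f_h(t_n)-f_h(s_n)$ and $Y_n(f)=f_h(t_{n-1})-f_h(s_n)$. *)

theory Defs
  imports "HOL-Analysis.Analysis"
begin

text \<open>
  A function on \<open>[0,\<infinity>)\<close> is a total function \<open>real \<Rightarrow> real\<close> of which only the values on
  \<open>{0..}\<close> are ever used.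
\<close>

subsection \<open>The tree coded by a function\<close>

definition C0_plus :: "(real \<Rightarrow> real) set" where
  "C0_plus = {f. continuous_on {0..} f \<and> (\<forall>t\<ge>0. 0 \<le> f t) \<and> f 0 = 0
                 \<and> compact (closure {t\<in>{0..}. f t \<noteq> 0})}"

definition code_dist :: "(real \<Rightarrow> real) \<Rightarrow> real \<Rightarrow> real \<Rightarrow> real" where
  "code_dist f s t = f s + f t - 2 * (INF u\<in>{min s t..max s t}. f u)"

definition code_rel :: "(real \<Rightarrow> real) \<Rightarrow> (real \<times> real) set" where
  "code_rel f = {(s, t). 0 \<le> s \<and> 0 \<le> t \<and> code_dist f s t = 0}"

definition coded_tree :: "(real \<Rightarrow> real) \<Rightarrow> real set set" where
  "coded_tree f = {0..} // code_rel f"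

definition tree_proj :: "(real \<Rightarrow> real) \<Rightarrow> real \<Rightarrow> real set" where
  "tree_proj f t = code_rel f `` {t}"

definition tree_root :: "(real \<Rightarrow> real) \<Rightarrow> real set" where
  "tree_root f = tree_proj f 0"

text \<open>The value of \<open>code_dist f\<close> on arbitrary representatives of the two classes.\<close>

definition tree_dist :: "(real \<Rightarrow> real) \<Rightarrow> real set \<Rightarrow> real set \<Rightarrow> real" where
  "tree_dist f x y = (THE r. \<exists>s\<in>x. \<exists>t\<in>y. r = code_dist f s t)"

definition tree_le :: "(real \<Rightarrow> real) \<Rightarrow> real set \<Rightarrow> real set \<Rightarrow> bool" where
  "tree_le f x y \<longleftrightarrow>
     tree_dist f y x = tree_dist f (tree_root f) y - tree_dist f (tree_root f) x"

text \<open>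
  The supremum is taken in the reals; for \<open>f \<in> C0_plus\<close> the set is non-empty (it contains
  \<open>tree_dist f x x\<close>) and bounded, so it is the genuine supremum.
\<close>

definition trimming :: "real \<Rightarrow> (real \<Rightarrow> real) \<Rightarrow> real set set" where
  "trimming h f =
     {x \<in> coded_tree f. (SUP y\<in>{y \<in> coded_tree f. tree_le f x y}. tree_dist f x y) \<ge> h}"


subsection \<open>Two-sided Skorohod reflection\<close>

definition measure_support :: "'a::topological_space measure \<Rightarrow> 'a set" where
  "measure_support M = {x. \<forall>U. open U \<longrightarrow> x \<in> U \<longrightarrow> emeasure M U \<noteq> 0}"

text \<open>
  The Stieltjes measure \<open>dc\<close> of a continuous non-decreasing function \<open>c\<close> on \<open>[0,\<infinity>)\<close>, seen as
  a measure on the whole line that does not charge \<open>(-\<infinity>,0)\<close>. For non-increasing \<open>c\<close> the support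
  of \<open>dc\<close> is that of the measure \<open>d(-c)\<close>.
\<close>

definition stieltjes :: "(real \<Rightarrow> real) \<Rightarrow> real measure" where
  "stieltjes c = interval_measure (\<lambda>t. c (max 0 t))"

definition skorohod_pair ::
    "real \<Rightarrow> (real \<Rightarrow> real) \<Rightarrow> (real \<Rightarrow> real) \<Rightarrow> (real \<Rightarrow> real) \<Rightarrow> bool" where
  "skorohod_pair h f c0 ch \<longleftrightarrow>
     continuous_on {0..} c0 \<and> continuous_on {0..} ch \<and> c0 0 = 0 \<and> ch 0 = 0 \<and>
     (\<forall>t\<ge>0. f t + c0 t + ch t \<in> {0..h}) \<and>
     mono_on {0..} c0 \<and> antimono_on {0..} ch \<and>
     measure_support (stieltjes c0) \<subseteq> {t. 0 \<le> t \<and> f t + c0 t + ch t = 0} \<and>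
     measure_support (stieltjes (\<lambda>t. - ch t)) \<subseteq> {t. 0 \<le> t \<and> f t + c0 t + ch t = h}"

text \<open>
  The pair is unique only as a pair of functions on \<open>[0,\<infinity>)\<close>; its values on negative arguments
  are unconstrained and irrelevant, hence a choice instead of a definite description.
\<close>

definition skorohod :: "real \<Rightarrow> (real \<Rightarrow> real) \<Rightarrow> (real \<Rightarrow> real) \<times> (real \<Rightarrow> real)" where
  "skorohod h f = (SOME c. skorohod_pair h f (fst c) (snd c))"

definition reflected :: "real \<Rightarrow> (real \<Rightarrow> real) \<Rightarrow> real \<Rightarrow> real" where
  "reflected h f t = f t + fst (skorohod h f) t + snd (skorohod h f) t"

definition h_cut :: "real \<Rightarrow> (real \<Rightarrow> real) \<Rightarrow> real \<Rightarrow> real" where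
  "h_cut h f t = f t - reflected h f t"


subsection \<open>Times and lengths\<close>

text \<open>Times are extended reals; in \<^typ>\<open>ereal\<close> the infimum of the empty set is \<open>\<infinity>\<close>.\<close>

definition hit_after :: "(real \<Rightarrow> real) \<Rightarrow> real \<Rightarrow> ereal \<Rightarrow> ereal" where
  "hit_after g a \<tau> = Inf (ereal ` {u. 0 \<le> u \<and> \<tau> < ereal u \<and> g u = a})"

primrec t_time :: "real \<Rightarrow> (real \<Rightarrow> real) \<Rightarrow> nat \<Rightarrow> ereal" where
  "t_time h f 0 = 0"
| "t_time h f (Suc n) = hit_after (reflected h f) 0 (hit_after (reflected h f) h (t_time h f n))"

text \<open>
  The time called \<open>T\<^sub>n\<close> is \<open>hit_after (reflected h f) h (t_time h f (n - 1))\<close>.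
  The empty supremum is set to \<open>\<infinity>\<close> explicitly, as it would be \<open>-\<infinity>\<close> in \<^typ>\<open>ereal\<close>.
\<close>

definition s_time :: "real \<Rightarrow> (real \<Rightarrow> real) \<Rightarrow> nat \<Rightarrow> ereal" where
  "s_time h f n =
     (let S = {u. t_time h f (n - 1) \<le> ereal u \<and> ereal u < t_time h f n \<and> reflected h f u = 0}
      in if S = {} then \<infinity> else Sup (ereal ` S))"

definition N_count :: "real \<Rightarrow> (real \<Rightarrow> real) \<Rightarrow> enat" where
  "N_count h f = Sup (enat ` {n. t_time h f n < \<infinity>})"

text \<open>\<open>X_len\<close> and \<open>Y_len\<close> are meaningful for \<open>1 \<le> n\<close> and \<open>enat n \<le> N_count h f\<close> only.\<close>

definition X_len :: "real \<Rightarrow> (real \<Rightarrow> real) \<Rightarrow> nat \<Rightarrow> real" where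
  "X_len h f n = h_cut h f (real_of_ereal (t_time h f n)) - h_cut h f (real_of_ereal (s_time h f n))"

definition Y_len :: "real \<Rightarrow> (real \<Rightarrow> real) \<Rightarrow> nat \<Rightarrow> real" where
  "Y_len h f n =
     h_cut h f (real_of_ereal (t_time h f (n - 1))) - h_cut h f (real_of_ereal (s_time h f n))"


subsection \<open>The grafting algorithm\<close>

text \<open>
  A point \<open>(k, r)\<close> is the point of the \<open>k\<close>-th branch at distance \<open>r\<close> from the base of that branch.
  The base of the first branch is the root \<open>(1, 0)\<close>; the base of a later branch is identified with
  the grafting point, so such a branch contributes only points with \<open>r > 0\<close>.
\<close>

record rtree =
  points :: "(nat \<times> real) set"
  rdist :: "nat \<times> real \<Rightarrow> nat \<times> real \<Rightarrow> real"
  origin :: "nat \<times> real"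
  tip :: "nat \<times> real"

definition single_branch :: "real \<Rightarrow> rtree" where
  "single_branch L =
     \<lparr>points = {1} \<times> {0..L}, rdist = (\<lambda>u v. \<bar>snd u - snd v\<bar>), origin = (1, 0), tip = (1, L)\<rparr>"

text \<open>
  Gluing a segment of length \<open>L\<close>, with fresh label \<open>n\<close>, by one of its endpoints to the point \<open>p\<close>.
  If \<open>L = 0\<close> the segment is a single point, and both its endpoints are identified with \<open>p\<close>.
\<close>

definition graft :: "nat \<Rightarrow> (nat \<times> real) \<Rightarrow> real \<Rightarrow> rtree \<Rightarrow> rtree" where
  "graft n p L T =
     \<lparr>points = points T \<union> {n} \<times> {0<..L},
      rdist = (\<lambda>u v.
        if fst u = n \<and> fst v = n then \<bar>snd u - snd v\<bar>
        else if fst u = n then snd u + rdist T p v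
        else if fst v = n then rdist T u p + snd v
        else rdist T u v),
      origin = origin T,
      tip = (if L = 0 then p else (n, L))\<rparr>"

text \<open>The points of the geodesics from \<open>a\<close> to \<open>b\<close> (in a real tree there is exactly one).\<close>

definition geodesic :: "'a set \<Rightarrow> ('a \<Rightarrow> 'a \<Rightarrow> real) \<Rightarrow> 'a \<Rightarrow> 'a \<Rightarrow> 'a set" where
  "geodesic M d a b =
     {x. \<exists>\<gamma>. \<gamma> ` {0..d a b} \<subseteq> M \<and> \<gamma> 0 = a \<and> \<gamma> (d a b) = b \<and>
             (\<forall>s\<in>{0..d a b}. \<forall>t\<in>{0..d a b}. d (\<gamma> s) (\<gamma> t) = \<bar>s - t\<bar>) \<and>
             x \<in> \<gamma> ` {0..d a b}}"

text \<open>
  \<open>after_step N X Y n T\<close>: the first \<open>n\<close> steps can be carried out without stopping, and \<open>T\<close> is the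
  resulting tree. A step requires that the branch length is non-negative and that the prescribed
  grafting point exists. The algorithm stops in step \<open>n + 1\<close> when \<open>n + 1 > N\<close>.
\<close>

inductive after_step ::
    "enat \<Rightarrow> (nat \<Rightarrow> real) \<Rightarrow> (nat \<Rightarrow> real) \<Rightarrow> nat \<Rightarrow> rtree \<Rightarrow> bool"
  for N :: enat and X Y :: "nat \<Rightarrow> real" where
  step_1: "0 \<le> X 1 \<Longrightarrow> after_step N X Y 1 (single_branch (X 1))"
| step_n: "after_step N X Y (n - 1) T \<Longrightarrow> 2 \<le> n \<Longrightarrow> enat n \<le> N \<Longrightarrow> 0 \<le> X n \<Longrightarrow>
           p \<in> geodesic (points T) (rdist T) (origin T) (tip T) \<Longrightarrow> rdist T p (tip T) = Y n \<Longrightarrow>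
           after_step N X Y n (graft n p (X n) T)"

definition generated_tree :: "enat \<Rightarrow> (nat \<Rightarrow> real) \<Rightarrow> (nat \<Rightarrow> real) \<Rightarrow> rtree \<Rightarrow> bool" where
  "generated_tree N X Y T \<longleftrightarrow> (\<exists>n. after_step N X Y n T \<and> enat (n + 1) > N)"


definition root_isometric ::
    "'a set \<Rightarrow> ('a \<Rightarrow> 'a \<Rightarrow> real) \<Rightarrow> 'a \<Rightarrow> 'b set \<Rightarrow> ('b \<Rightarrow> 'b \<Rightarrow> real) \<Rightarrow> 'b \<Rightarrow> bool" where
  "root_isometric M d a M' d' a' \<longleftrightarrow>
     a \<in> M \<and> a' \<in> M' \<and>
     (\<exists>\<phi>. bij_betw \<phi> M M' \<and> (\<forall>x\<in>M. \<forall>y\<in>M. d' (\<phi> x) (\<phi> y) = d x y) \<and> \<phi> a = a')"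

end

theory Submission
  imports Defs
begin

text \<open>
  Write \<open>g\<close> for the cut function and \<open>L = f - g\<close> for the reflected one, so \<open>0 \<le> L \<le> h\<close>. The pushes
  of the reflection make \<open>g\<close> go down only while \<open>L = 0\<close>, that is \<open>g = f\<close>, and up only while
  \<open>L = h\<close>, that is \<open>g = f - h\<close>.

  The first half of the proof shows that \<open>g\<close> codes the trimmed tree. Send a time \<open>s\<close> to the ancestor
  at height \<open>g s\<close> of the point that \<open>s\<close> codes in the tree of \<open>f\<close>. If \<open>g\<close> dips between \<open>s\<close> and \<open>t\<close>
  below both \<open>g s\<close> and \<open>g t\<close>, it goes down to its minimum, so there it agrees with \<open>f\<close>; as \<open>g \<le> f\<close>
  everywhere, the ancestors of \<open>s\<close> and \<open>t\<close> branch off each other at the height \<open>min g\<close>, and their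
  distance is the one that \<open>g\<close> prescribes; without a dip one of the two ancestors lies above the
  other (\<open>code_dist_foot\<close>). These ancestors are exactly the points
  of the trimming (\<open>trimming_eq_nodes\<close>): the last time before \<open>s\<close> with \<open>L = h\<close> codes a
  descendant at distance at least \<open>h\<close>, and conversely, if a point at height \<open>a\<close> has a descendant at
  height \<open>a + h\<close>, then \<open>g\<close> takes the value \<open>a\<close> between times that code the two.

  The second half reads the tree of \<open>g\<close> branch by branch. Each time \<open>L\<close> goes from \<open>0\<close>
  up to \<open>h\<close> and back to \<open>0\<close>, the function \<open>g\<close> first goes down by \<open>Y n\<close> and then up by \<open>X n\<close>. While it goes down it
  revisits ancestors of the previous tip, and while it goes up it draws a new branch from the
  ancestor it has reached: this is a step of the algorithm (\<open>coded_upto_graft\<close>). By compactness there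
  are finitely many such rounds, after which \<open>g\<close> only goes down and adds no point.

  All this presupposes a reflection pair. It is built on a fine grid: where \<open>f\<close> oscillates by
  at most \<open>h / 2\<close> one barrier is enough, and one-sided reflection has an explicit solution by a
  running maximum (\<open>reflects_upto_extend_low\<close>).
\<close>

section \<open>The pseudo-distance of a continuous function\<close>

abbreviation betw :: "real \<Rightarrow> real \<Rightarrow> real set" where
  "betw s t \<equiv> {min s t..max s t}"

lemma inf_attained:
  fixes g :: "real \<Rightarrow> real"
  assumes "continuous_on {0..} g" "0 \<le> s" "0 \<le> t"
  obtains u where "u \<in> betw s t" "(INF v\<in>betw s t. g v) = g u" "\<And>v. v \<in> betw s t \<Longrightarrow> g u \<le> g v"
proof -
  have "continuous_on (betw s t) g"
    using assms(1) by (rule continuous_on_subset) (use assms(2,3) in auto)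
  then obtain u where u: "u \<in> betw s t" "\<And>v. v \<in> betw s t \<Longrightarrow> g u \<le> g v"
    using continuous_attains_inf[of "betw s t" g] by fastforce
  moreover have "(INF v\<in>betw s t. g v) = g u"
    using u by (intro cInf_eq_minimum) auto
  ultimately show thesis using that by blast
qed

lemma inf_le:
  fixes g :: "real \<Rightarrow> real"
  assumes "continuous_on {0..} g" "0 \<le> s" "0 \<le> t" "v \<in> betw s t"
  shows "(INF v\<in>betw s t. g v) \<le> g v"
  using inf_attained[OF assms(1-3)] assms(4) by metis

lemma le_inf_iff:
  fixes g :: "real \<Rightarrow> real"
  assumes "continuous_on {0..} g" "0 \<le> s" "0 \<le> t"
  shows "c \<le> (INF v\<in>betw s t. g v) \<longleftrightarrow> (\<forall>v\<in>betw s t. c \<le> g v)"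
  using inf_attained[OF assms] inf_le[OF assms] by (metis order_trans)

lemma code_dist_commute: "code_dist g s t = code_dist g t s"
  by (simp add: code_dist_def min.commute max.commute)

lemma code_dist_self [simp]: "code_dist g s s = 0"
  by (simp add: code_dist_def)

lemma code_dist_ge:
  assumes "continuous_on {0..} g" "0 \<le> s" "0 \<le> t"
  shows "\<bar>g s - g t\<bar> \<le> code_dist g s t"
  using inf_le[OF assms, of s] inf_le[OF assms, of t] by (simp add: code_dist_def)

text \<open>When the minimum over the interval is taken at \<open>s\<close>, the point \<open>s\<close> codes an ancestor of \<open>t\<close>.\<close>

lemma code_dist_ancestor_iff:
  assumes "continuous_on {0..} g" "0 \<le> s" "0 \<le> t"
  shows "code_dist g s t = g t - g s \<longleftrightarrow> (\<forall>v\<in>betw s t. g s \<le> g v)"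
proof -
  have "code_dist g s t = g t - g s \<longleftrightarrow> g s \<le> (INF v\<in>betw s t. g v)"
    using inf_le[OF assms, of s] by (auto simp: code_dist_def)
  then show ?thesis using le_inf_iff[OF assms] by blast
qed

lemma code_dist_eq_0_iff:
  assumes "continuous_on {0..} g" "0 \<le> s" "0 \<le> t"
  shows "code_dist g s t = 0 \<longleftrightarrow> g s = g t \<and> (\<forall>v\<in>betw s t. g s \<le> g v)"
  using code_dist_ancestor_iff[OF assms] code_dist_ge[OF assms] by auto

text \<open>
  The minimum over the interval from \<open>a\<close> to \<open>c\<close> is taken on the \<open>a\<close> or on the \<open>c\<close> side of \<open>b\<close>, and on
  the other side the minimum is at most \<open>g b\<close>.
\<close>

lemma code_dist_triangle:
  assumes g: "continuous_on {0..} g" and "0 \<le> a" "0 \<le> b" "0 \<le> c"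
  shows "code_dist g a c \<le> code_dist g a b + code_dist g b c"
proof -
  obtain u where u: "u \<in> betw a c" "(INF v\<in>betw a c. g v) = g u"
    using inf_attained[OF g assms(2,4)] by blast
  have "u \<in> betw a b \<or> u \<in> betw b c"
    using u(1) by auto
  then have "(INF v\<in>betw a b. g v) \<le> g u \<or> (INF v\<in>betw b c. g v) \<le> g u"
    using inf_le g assms by blast
  moreover have "(INF v\<in>betw a b. g v) \<le> g b" "(INF v\<in>betw b c. g v) \<le> g b"
    using inf_le g assms by simp_all
  ultimately show ?thesis
    using u(2) by (auto simp: code_dist_def)
qed

lemma code_dist_cong:
  assumes "continuous_on {0..} g" "0 \<le> a" "0 \<le> b" "0 \<le> c" "code_dist g a b = 0"
  shows "code_dist g a c = code_dist g b c" "code_dist g c a = code_dist g c b"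
proof -
  show *: "code_dist g a c = code_dist g b c"
    using code_dist_triangle[of g a b c] code_dist_triangle[of g b a c] assms
    by (simp add: code_dist_commute[of g b a])
  then show "code_dist g c a = code_dist g c b"
    by (simp add: code_dist_commute)
qed

lemma code_dist_root:
  assumes "continuous_on {0..} g" "\<And>t. 0 \<le> t \<Longrightarrow> 0 \<le> g t" "g 0 = 0" "0 \<le> t"
  shows "code_dist g 0 t = g t"
  using code_dist_ancestor_iff[of g 0 t] assms by auto

lemma last_time:
  fixes g :: "real \<Rightarrow> real"
  assumes "continuous_on {a..b} g" and w: "w \<in> {a..b}" "g w = y"
  obtains u where "a \<le> u" "u \<le> b" "g u = y" "\<And>v. u < v \<Longrightarrow> v \<le> b \<Longrightarrow> g v \<noteq> y"
proof -
  define S where "S = {u \<in> {a..b}. g u = y}"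
  have ne: "S \<noteq> {}" using w by (auto simp: S_def)
  have "closed S"
    unfolding S_def using continuous_closed_preimage_constant[OF assms(1)] by simp
  moreover have "bounded S"
    by (rule bounded_subset[of "{a..b}"]) (auto simp: S_def)
  ultimately have "compact S"
    by (simp add: compact_eq_bounded_closed)
  then obtain u where u: "u \<in> S" "\<And>w. w \<in> S \<Longrightarrow> w \<le> u"
    using compact_attains_sup[OF _ ne] by blast
  have "g v \<noteq> y" if "u < v" "v \<le> b" for v
    using u(1) u(2)[of v] that by (auto simp: S_def)
  with u(1) show thesis using that by (auto simp: S_def)
qed

text \<open>
  The last visit to a level before \<open>b\<close>: in the tree coded by \<open>g\<close>, it is the ancestor of \<open>b\<close> at
  height \<open>y\<close>.
\<close>

lemma last_visit:
  fixes g :: "real \<Rightarrow> real"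
  assumes "continuous_on {a..b} g" "a \<le> b" "g a \<le> y" "y \<le> g b"
  obtains u where "a \<le> u" "u \<le> b" "g u = y" "\<And>v. u \<le> v \<Longrightarrow> v \<le> b \<Longrightarrow> y \<le> g v"
proof -
  have "\<exists>w\<ge>a. w \<le> b \<and> g w = y"
    using IVT'[of g a y b] assms by blast
  then obtain u where u: "a \<le> u" "u \<le> b" "g u = y" "\<And>v. u < v \<Longrightarrow> v \<le> b \<Longrightarrow> g v \<noteq> y"
    using last_time[OF assms(1)] by (metis atLeastAtMost_iff)
  have "y \<le> g v" if "u \<le> v" "v \<le> b" for v
  proof (rule ccontr)
    assume "\<not> y \<le> g v"
    moreover have "continuous_on {v..b} g"
      using assms(1) by (rule continuous_on_subset) (use u that in auto)
    ultimately have "\<exists>w\<ge>v. w \<le> b \<and> g w = y"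
      using assms(4) that by (intro IVT') auto
    then obtain w where "v \<le> w" "w \<le> b" "g w = y" by blast
    with u(4)[of w] that(1) have "w = u" by force
    with \<open>v \<le> w\<close> \<open>u \<le> v\<close> \<open>g w = y\<close> \<open>\<not> y \<le> g v\<close> show False by auto
  qed
  with u show thesis using that by blast
qed

section \<open>The coded tree and its trimming\<close>

lemma equiv_code_rel:
  assumes "continuous_on {0..} g"
  shows "equiv {0..} (code_rel g)"
proof (rule equivI)
  show "code_rel g \<subseteq> {0..} \<times> {0..}" by (auto simp: code_rel_def)
  show "refl_on {0..} (code_rel g)" by (auto simp: refl_on_def code_rel_def)
  show "sym (code_rel g)" by (auto simp: sym_def code_rel_def code_dist_commute)
  show "trans (code_rel g)"
  proof (rule transI)
    fix a b c assume "(a, b) \<in> code_rel g" "(b, c) \<in> code_rel g"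
    then show "(a, c) \<in> code_rel g"
      using code_dist_cong(1)[OF assms, of a b c] by (simp add: code_rel_def)
  qed
qed

lemma tree_proj_eq_iff:
  assumes "continuous_on {0..} g" "0 \<le> s" "0 \<le> t"
  shows "tree_proj g s = tree_proj g t \<longleftrightarrow> code_dist g s t = 0"
  using eq_equiv_class_iff[OF equiv_code_rel[OF assms(1)], of s t] assms
  by (simp add: tree_proj_def code_rel_def)

lemma coded_tree_eq: "coded_tree g = tree_proj g ` {0..}"
  by (auto simp: coded_tree_def tree_proj_def quotient_def)

lemma tree_dist_proj:
  assumes g: "continuous_on {0..} g" and "0 \<le> s" "0 \<le> t"
  shows "tree_dist g (tree_proj g s) (tree_proj g t) = code_dist g s t"
  unfolding tree_dist_def
proof (rule the_equality)
  show "\<exists>s'\<in>tree_proj g s. \<exists>t'\<in>tree_proj g t. code_dist g s t = code_dist g s' t'"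
    by (rule bexI[of _ s], rule bexI[of _ t]) (use assms in \<open>auto simp: tree_proj_def code_rel_def\<close>)
next
  fix r assume "\<exists>s'\<in>tree_proj g s. \<exists>t'\<in>tree_proj g t. r = code_dist g s' t'"
  then obtain s' t' where *: "0 \<le> s'" "0 \<le> t'" "code_dist g s s' = 0" "code_dist g t t' = 0"
      "r = code_dist g s' t'"
    by (auto simp: tree_proj_def code_rel_def)
  then show "r = code_dist g s t"
    using code_dist_cong(1)[OF g, of s s' t'] code_dist_cong(2)[OF g, of t t' s] assms by simp
qed

lemma C0_plusD:
  assumes "f \<in> C0_plus"
  shows "continuous_on {0..} f" "0 \<le> t \<Longrightarrow> 0 \<le> f t" "f 0 = 0"
    "\<exists>B\<ge>0. \<forall>t\<ge>B. f t = 0"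
proof -
  show "continuous_on {0..} f" "0 \<le> t \<Longrightarrow> 0 \<le> f t" "f 0 = 0"
    using assms by (auto simp: C0_plus_def)
  have "bounded {t\<in>{0..}. f t \<noteq> 0}"
    using assms by (auto simp: C0_plus_def intro: bounded_subset[OF compact_imp_bounded closure_subset])
  then obtain B where B: "\<And>t. 0 \<le> t \<Longrightarrow> f t \<noteq> 0 \<Longrightarrow> \<bar>t\<bar> \<le> B"
    by (auto simp: bounded_real)
  have "f t = 0" if "\<bar>B\<bar> + 1 \<le> t" for t
  proof (rule ccontr)
    assume "f t \<noteq> 0"
    with B[of t] that show False by linarith
  qed
  then show "\<exists>B\<ge>0. \<forall>t\<ge>B. f t = 0"
    by (intro exI[of _ "\<bar>B\<bar> + 1"]) simp
qed

lemma tree_le_proj: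
  assumes f: "f \<in> C0_plus" and "0 \<le> s" "0 \<le> t"
  shows "tree_le f (tree_proj f s) (tree_proj f t) \<longleftrightarrow> (\<forall>v\<in>betw s t. f s \<le> f v)"
proof -
  note cont = C0_plusD(1)[OF f]
  have "code_dist f 0 s = f s" "code_dist f 0 t = f t"
    using code_dist_root[OF cont] C0_plusD(2,3)[OF f] assms(2,3) by blast+
  then have "tree_le f (tree_proj f s) (tree_proj f t) \<longleftrightarrow> code_dist f s t = f t - f s"
    using tree_dist_proj[OF cont] assms(2,3)
    by (simp add: tree_le_def tree_root_def code_dist_commute)
  then show ?thesis
    using code_dist_ancestor_iff[OF cont assms(2,3)] by simp
qed

text \<open>
  The supremum that defines the trimming is a maximum: the times coding descendants of \<open>s\<close> form a
  closed set, and outside a compact interval \<open>f\<close> vanishes.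
\<close>

lemma proj_in_trimming_iff:
  assumes f: "f \<in> C0_plus" and s: "0 \<le> s" and h: "0 < h"
  shows "tree_proj f s \<in> trimming h f \<longleftrightarrow>
    (\<exists>t\<ge>0. f s + h \<le> f t \<and> (\<forall>v\<in>betw s t. f s \<le> f v))"
proof -
  note cont = C0_plusD(1)[OF f]
  define V where "V = {t. 0 \<le> t \<and> (\<forall>v\<in>betw s t. f s \<le> f v)}"
  have "{y \<in> coded_tree f. tree_le f (tree_proj f s) y} = tree_proj f ` V"
    using tree_le_proj[OF f s] by (auto simp: coded_tree_eq V_def)
  moreover have "tree_dist f (tree_proj f s) (tree_proj f t) = f t - f s" if "t \<in> V" for t
    using that code_dist_ancestor_iff[OF cont s, of t] tree_dist_proj[OF cont s, of t]
    by (simp add: V_def)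
  ultimately have sup_eq: "(SUP y\<in>{y \<in> coded_tree f. tree_le f (tree_proj f s) y}.
      tree_dist f (tree_proj f s) y) = (SUP t\<in>V. f t - f s)"
    by (simp add: image_image cong: image_cong_simp)
  obtain B where B: "0 \<le> B" "\<And>t. B \<le> t \<Longrightarrow> f t = 0"
    using C0_plusD(4)[OF f] by blast
  define I where "I = {0..max s B}"
  \<comment> \<open>a time is out of \<open>V\<close> when it is low itself or strictly behind a low time \<open>z\<close>, seen from \<open>s\<close>\<close>
  have V_eq: "V \<inter> I = {t\<in>I. f s \<le> f t} \<inter> (\<Inter>z\<in>{z\<in>I. s < z \<and> f z < f s}. {..z})
      \<inter> (\<Inter>z\<in>{z\<in>I. z < s \<and> f z < f s}. {z..})" (is "_ = ?R")
  proof
    show "V \<inter> I \<subseteq> ?R"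
    proof
      fix t assume t: "t \<in> V \<inter> I"
      have below: "f s \<le> f v" if "v \<in> betw s t" for v
        using t that by (simp add: V_def)
      have "f s \<le> f t" using below by simp
      moreover have "t \<le> z" if "s < z" "f z < f s" for z
        by (rule ccontr) (use below[of z] that in auto)
      moreover have "z \<le> t" if "z < s" "f z < f s" for z
        by (rule ccontr) (use below[of z] that in auto)
      ultimately show "t \<in> ?R" using t by auto
    qed
    show "?R \<subseteq> V \<inter> I"
    proof
      fix t assume t: "t \<in> ?R"
      have "f s \<le> f v" if v: "v \<in> betw s t" for v
      proof (rule ccontr)
        assume neg: "\<not> f s \<le> f v"
        have "0 \<le> v" "v \<le> max s B" "v \<noteq> s" "v \<noteq> t"
          using v s t neg by (auto simp: I_def)
        moreover have "t \<le> v" if "s < v" "v \<le> max s B"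
          using t that neg s by (simp add: I_def)
        moreover have "v \<le> t" if "v < s" "0 \<le> v"
          using t that neg by (simp add: I_def)
        ultimately show False
          using v by (auto simp: min_def max_def split: if_splits)
      qed
      then show "t \<in> V \<inter> I" using t by (auto simp: V_def I_def)
    qed
  qed
  have contI: "continuous_on I f"
    using cont by (rule continuous_on_subset) (auto simp: I_def)
  have "closed {t\<in>I. f s \<le> f t}"
    using continuous_closed_preimage[OF contI, of "{f s..}"]
    by (auto simp: I_def vimage_def Int_def)
  then have "closed (V \<inter> I)"
    unfolding V_eq by (intro closed_Int closed_INT ballI) auto
  then have "compact (V \<inter> I)"
    using bounded_subset[of I "V \<inter> I"] by (simp add: compact_eq_bounded_closed I_def)
  moreover have "s \<in> V \<inter> I" using s by (auto simp: V_def I_def)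
  moreover have "continuous_on (V \<inter> I) f"
    using contI by (rule continuous_on_subset) auto
  ultimately obtain m where m: "m \<in> V \<inter> I" "\<And>t. t \<in> V \<inter> I \<Longrightarrow> f t \<le> f m"
    using continuous_attains_sup[of "V \<inter> I" f] by blast
  have max: "f t \<le> f m" if "t \<in> V" for t
  proof (cases "t \<in> I")
    case False
    then have "f t = 0" using that B by (auto simp: I_def V_def)
    then show ?thesis using C0_plusD(2)[OF f, of m] m(1) by (auto simp: V_def)
  qed (use that m in auto)
  have "(SUP t\<in>V. f t - f s) = f m - f s"
    using m(1) max by (intro cSup_eq_maximum) auto
  then have "tree_proj f s \<in> trimming h f \<longleftrightarrow> f s + h \<le> f m"
    using s sup_eq by (auto simp: trimming_def coded_tree_eq)
  also have "\<dots> \<longleftrightarrow> (\<exists>t\<in>V. f s + h \<le> f t)"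
    using m(1) max order_trans by blast
  finally show ?thesis unfolding V_def by blast
qed

section \<open>Existence of the two-sided reflection\<close>

lemma stieltjes_Ioc:
  assumes "continuous_on {0..} c" "mono_on {0..} c" "a \<le> b"
  shows "emeasure (stieltjes c) {a<..b} = ennreal (c (max 0 b) - c (max 0 a))"
proof -
  have "continuous_on UNIV (\<lambda>t. c (max 0 t))"
    by (rule continuous_on_compose2[OF assms(1)]) (auto intro!: continuous_intros)
  then have "continuous (at_right x) (\<lambda>t. c (max 0 t))" for x
    by (auto simp: continuous_on_eq_continuous_within intro: continuous_within_subset)
  then show ?thesis
    unfolding stieltjes_def
    using assms(2,3) by (intro emeasure_interval_measure_Ioc) (auto simp: mono_on_def)
qed

text \<open>
  A continuous non-decreasing \<open>c\<close> grows only on a closed set \<open>Z\<close>, in the sense that the support of its Stieltjes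
  measure lies in \<open>Z\<close>, if and only if it is constant on the intervals that avoid \<open>Z\<close>. Both
  directions are needed: one to construct a reflection, the other to work with it.
\<close>

lemma const_off_support:
  assumes c: "continuous_on {0..} c" "mono_on {0..} c"
    and supp: "measure_support (stieltjes c) \<subseteq> Z"
    and st: "0 \<le> s" "s \<le> t" and off: "\<And>u. u \<in> {s..t} \<Longrightarrow> u \<notin> Z"
  shows "c s = c t"
proof -
  have "\<forall>u\<in>{s..t}. \<exists>U. open U \<and> u \<in> U \<and> emeasure (stieltjes c) U = 0"
    using supp off unfolding measure_support_def by blast
  then obtain U where U: "\<And>u. u \<in> {s..t} \<Longrightarrow> open (U u) \<and> u \<in> U u \<and> emeasure (stieltjes c) (U u) = 0"
    by metis
  have "{s..t} \<subseteq> (\<Union>u\<in>{s..t}. U u)" using U by blast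
  then obtain D where D: "D \<subseteq> {s..t}" "finite D" "{s..t} \<subseteq> (\<Union>u\<in>D. U u)"
    by (rule compactE_image[OF compact_Icc, rotated]) (use U in auto)
  have sets: "sets (stieltjes c) = sets borel" by (simp add: stieltjes_def)
  have "emeasure (stieltjes c) (\<Union>u\<in>D. U u) \<le> (\<Sum>u\<in>D. emeasure (stieltjes c) (U u))"
    using D U by (intro emeasure_subadditive_finite) (auto simp: sets)
  also have "\<dots> = 0" using D U by (intro sum.neutral) auto
  finally have "emeasure (stieltjes c) (\<Union>u\<in>D. U u) = 0" by simp
  moreover have "emeasure (stieltjes c) {s<..t} \<le> emeasure (stieltjes c) (\<Union>u\<in>D. U u)"
    using D U by (intro emeasure_mono) (auto simp: sets intro!: borel_open open_UN)
  ultimately have "ennreal (c t - c s) = 0"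
    using stieltjes_Ioc[OF c st(2)] st by simp
  moreover have "c s \<le> c t" using c(2) st by (simp add: mono_on_def)
  ultimately show ?thesis by (simp add: ennreal_eq_0_iff)
qed

lemma support_if_const_off:
  fixes L :: "real \<Rightarrow> real"
  assumes c: "continuous_on {0..} c" "mono_on {0..} c" and L: "continuous_on {0..} L"
    and const: "\<And>s t. 0 \<le> s \<Longrightarrow> s \<le> t \<Longrightarrow> (\<And>u. u \<in> {s..t} \<Longrightarrow> L u \<noteq> a) \<Longrightarrow> c s = c t"
  shows "measure_support (stieltjes c) \<subseteq> {t. 0 \<le> t \<and> L t = a}"
proof
  fix x assume x: "x \<in> measure_support (stieltjes c)"
  have null: False if "p < x" "x < q" "c (max 0 p) = c (max 0 q)" for p q
  proof -
    have "emeasure (stieltjes c) {p<..<q} \<le> emeasure (stieltjes c) {p<..q}"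
      by (intro emeasure_mono) (auto simp: stieltjes_def)
    also have "\<dots> = 0" using stieltjes_Ioc[OF c, of p q] that by simp
    finally show False
      using x that by (auto simp: measure_support_def dest: spec[of _ "{p<..<q}"])
  qed
  have "0 \<le> x"
    using null[of "x - 1" 0] by fastforce
  moreover have "L x = a"
  proof (rule ccontr)
    assume "L x \<noteq> a"
    with \<open>0 \<le> x\<close> L obtain e where e: "0 < e" "\<And>u. 0 \<le> u \<Longrightarrow> dist u x < e \<Longrightarrow> dist (L u) (L x) < dist (L x) a"
      by (metis atLeast_iff continuous_on_iff zero_less_dist_iff)
    have "c (max 0 (x - e / 2)) = c (x + e / 2)"
    proof (rule const)
      fix u assume "u \<in> {max 0 (x - e / 2)..x + e / 2}"
      then have "dist (L u) (L x) < dist (L x) a"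
        using e(1) by (intro e(2)) (auto simp: dist_real_def)
      then show "L u \<noteq> a" by (auto simp: dist_commute)
    qed (use \<open>0 \<le> x\<close> e in auto)
    then show False
      using null[of "x - e / 2" "x + e / 2"] \<open>0 \<le> x\<close> e(1) by simp
  qed
  ultimately show "x \<in> {t. 0 \<le> t \<and> L t = a}" by simp
qed

text \<open>
  The reflection on \<open>[0,b]\<close>, with the upward push \<open>c\<close> and the downward push \<open>d\<close> both non-decreasing.
  In this form reflecting \<open>h - f\<close> amounts to exchanging \<open>c\<close> and \<open>d\<close>.
\<close>

definition reflects_upto ::
    "real \<Rightarrow> (real \<Rightarrow> real) \<Rightarrow> real \<Rightarrow> (real \<Rightarrow> real) \<Rightarrow> (real \<Rightarrow> real) \<Rightarrow> bool" where
  "reflects_upto h f b c d \<longleftrightarrow>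
     continuous_on {0..b} c \<and> continuous_on {0..b} d \<and> c 0 = 0 \<and> d 0 = 0 \<and>
     mono_on {0..b} c \<and> mono_on {0..b} d \<and>
     (\<forall>t\<in>{0..b}. f t + c t - d t \<in> {0..h}) \<and>
     (\<forall>s t. 0 \<le> s \<longrightarrow> s \<le> t \<longrightarrow> t \<le> b \<longrightarrow> (\<forall>u\<in>{s..t}. f u + c u - d u \<noteq> 0) \<longrightarrow> c s = c t) \<and>
     (\<forall>s t. 0 \<le> s \<longrightarrow> s \<le> t \<longrightarrow> t \<le> b \<longrightarrow> (\<forall>u\<in>{s..t}. f u + c u - d u \<noteq> h) \<longrightarrow> d s = d t)"

lemma reflects_upto_swap:
  "reflects_upto h f b c d \<longleftrightarrow> reflects_upto h (\<lambda>t. h - f t) b d c"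
proof -
  have "h - f t + d t - c t = 0 \<longleftrightarrow> f t + c t - d t = h"
    "h - f t + d t - c t = h \<longleftrightarrow> f t + c t - d t = 0"
    "h - f t + d t - c t \<in> {0..h} \<longleftrightarrow> f t + c t - d t \<in> {0..h}" for t
    by auto
  then show ?thesis unfolding reflects_upto_def by (simp only:) blast
qed

lemma running_max:
  fixes e :: "real \<Rightarrow> real"
  assumes e: "continuous_on {0..b} e"
  obtains R where "continuous_on {0..b} R" "mono_on {0..b} R"
    "\<And>t. t \<in> {0..b} \<Longrightarrow> e t \<le> R t"
    "\<And>t. t \<in> {0..b} \<Longrightarrow> \<exists>u\<in>{0..t}. e u = R t"
proof -
  define R where "R t = (SUP u\<in>{0..t}. e u)" for t
  have R: "\<exists>u\<in>{0..t}. e u = R t \<and> (\<forall>v\<in>{0..t}. e v \<le> e u)" if "t \<in> {0..b}" for t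
  proof -
    have "continuous_on {0..t} e"
      using e by (rule continuous_on_subset) (use that in auto)
    then have "\<exists>u\<in>{0..t}. \<forall>v\<in>{0..t}. e v \<le> e u"
      using that by (intro continuous_attains_sup) auto
    then obtain u where u: "u \<in> {0..t}" "\<forall>v\<in>{0..t}. e v \<le> e u" by blast
    then have "R t = e u"
      unfolding R_def by (intro cSup_eq_maximum) auto
    with u show ?thesis by auto
  qed
  have ge: "e v \<le> R t" if "t \<in> {0..b}" "0 \<le> v" "v \<le> t" for v t
    using R[of t] that by force
  have mono: "R s \<le> R t" if "0 \<le> s" "s \<le> t" "t \<le> b" for s t
    using R[of s] ge[of t] that by force
  have "uniformly_continuous_on {0..b} e"
    using e by (intro compact_uniformly_continuous) auto
  have "continuous_on {0..b} R"
    unfolding continuous_on_iff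
  proof (intro ballI allI impI)
    fix x r :: real assume x: "x \<in> {0..b}" and r: "0 < r"
    obtain k where k: "0 < k" "\<And>u v. u \<in> {0..b} \<Longrightarrow> v \<in> {0..b} \<Longrightarrow> dist v u < k \<Longrightarrow> dist (e v) (e u) < r"
      using \<open>uniformly_continuous_on {0..b} e\<close> r unfolding uniformly_continuous_on_def by metis
    have less: "R t < R s + r" if st: "0 \<le> s" "s \<le> t" "t \<le> b" "t - s < k" for s t
    proof -
      obtain u where u: "u \<in> {0..t}" "e u = R t" using R[of t] st by auto
      show ?thesis
      proof (cases "u \<le> s")
        case True
        then show ?thesis using ge[of s u] u r that by auto
      next
        case False
        then have "dist (e u) (e s) < r" using u that by (intro k(2)) (auto simp: dist_real_def)
        then show ?thesis using ge[of s s] u that by (auto simp: dist_real_def)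
      qed
    qed
    have "dist (R y) (R x) < r" if "y \<in> {0..b}" "dist y x < k" for y
      using less[of x y] less[of y x] mono[of x y] mono[of y x] x that
      by (cases "x \<le> y") (auto simp: dist_real_def)
    then show "\<exists>k>0. \<forall>y\<in>{0..b}. dist y x < k \<longrightarrow> dist (R y) (R x) < r"
      using k(1) by blast
  qed
  then show thesis
    using that[of R] R mono ge by (fastforce simp: mono_on_def)
qed

text \<open>
  On a stretch where \<open>f\<close> oscillates by at most \<open>h / 2\<close>, a path that starts in the lower half of
  \<open>[0,h]\<close> can be reflected at \<open>0\<close> alone: the running maximum of the deficit is the push needed, and
  the upper barrier is not crossed.
\<close>

lemma reflects_upto_extend_low:
  assumes f: "continuous_on {0..b'} f" and b: "0 \<le> b" "b \<le> b'" and h: "0 < h"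
    and osc: "\<And>s t. s \<in> {b..b'} \<Longrightarrow> t \<in> {b..b'} \<Longrightarrow> f s - f t \<le> h / 2"
    and refl: "reflects_upto h f b c d" and low: "f b + c b - d b \<le> h / 2"
  shows "\<exists>c' d'. reflects_upto h f b' c' d'"
proof -
  define x where "x = f b + c b - d b"
  have x: "0 \<le> x" "x \<le> h / 2"
    using refl low b by (auto simp: reflects_upto_def x_def)
  \<comment> \<open>the deficit below \<open>0\<close> of the path that follows \<open>f\<close> from level \<open>x\<close> at time \<open>b\<close>\<close>
  define e where "e t = max 0 (f b - f (max b t) - x)" for t
  have "continuous_on {0..b'} e"
    unfolding e_def using b
    by (intro continuous_intros continuous_on_compose2[OF f]) auto
  then obtain R where R: "continuous_on {0..b'} R" "mono_on {0..b'} R"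
      and R_ge: "\<And>t. t \<in> {0..b'} \<Longrightarrow> e t \<le> R t"
      and R_eq: "\<And>t. t \<in> {0..b'} \<Longrightarrow> \<exists>u\<in>{0..t}. e u = R t"
    using running_max by blast
  have e0: "e t = 0" if "t \<le> b" for t using that x by (simp add: e_def)
  have R_nonneg: "0 \<le> R t" if "t \<in> {0..b'}" for t
    using R_ge[OF that] by (simp add: e_def)
  have R0: "R t = 0" if "t \<in> {0..b}" for t
    using R_eq[of t] e0 that b by force
  define c' where "c' t = c (min b t) + R t" for t
  define d' where "d' t = d (min b t)" for t
  have cont: "continuous_on {0..b'} (\<lambda>t. c (min b t))" "continuous_on {0..b'} (\<lambda>t. d (min b t))"
    using refl b unfolding reflects_upto_def
    by (auto intro!: continuous_intros elim!: continuous_on_compose2)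
  have old: "f t + c' t - d' t = f t + c t - d t" if "t \<in> {0..b}" for t
    using that R0 by (simp add: c'_def d'_def)
  have new: "f t + c' t - d' t = x + f t - f b + R t" if "b \<le> t" for t
    using that by (simp add: c'_def d'_def x_def min_absorb1)
  have range: "f t + c' t - d' t \<in> {0..h}" if t: "t \<in> {0..b'}" for t
  proof (cases "t \<le> b")
    case True
    then have "t \<in> {0..b}" using t by simp
    moreover from this have "f t + c t - d t \<in> {0..h}"
      using refl unfolding reflects_upto_def by blast
    ultimately show ?thesis by (simp only: old)
  next
    case False
    then have "f b - f t - x \<le> R t" using R_ge[OF t] by (simp add: e_def)
    moreover have "x + f t - f b + R t \<le> h"
    proof -
      obtain u where u: "u \<in> {0..t}" "e u = R t" using R_eq[OF t] by blast
      show ?thesis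
      proof (cases "e u = 0")
        case True
        then show ?thesis using u x osc[of t b] False t b by auto
      next
        case neq: False
        then have "b < u" using e0[of u] by force
        then have "R t = f b - f u - x" using neq u by (auto simp: e_def max_def split: if_splits)
        then show ?thesis using osc[of t u] \<open>b < u\<close> u t h by auto
      qed
    qed
    ultimately show ?thesis using new[of t] False by auto
  qed
  have flat_c: "c (min b s) = c (min b t)"
    if "0 \<le> s" "s \<le> t" "\<And>u. u \<in> {s..t} \<Longrightarrow> f u + c' u - d' u \<noteq> 0" for s t
  proof (cases "s \<le> b")
    case True
    have "\<forall>u\<in>{s..min b t}. f u + c u - d u \<noteq> 0"
      using that old by (metis atLeastAtMost_iff min.boundedE order_trans)
    then show ?thesis using refl that True by (simp add: reflects_upto_def min_absorb2)
  qed (use that in \<open>simp add: min_absorb1\<close>)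
  have flat_d: "d' s = d' t"
    if "0 \<le> s" "s \<le> t" "\<And>u. u \<in> {s..t} \<Longrightarrow> f u + c' u - d' u \<noteq> h" for s t
  proof (cases "s \<le> b")
    case True
    have "\<forall>u\<in>{s..min b t}. f u + c u - d u \<noteq> h"
      using that old by (metis atLeastAtMost_iff min.boundedE order_trans)
    then show ?thesis using refl that True by (simp add: reflects_upto_def min_absorb2 d'_def)
  qed (use that in \<open>simp add: min_absorb1 d'_def\<close>)
  have flat_R: "R s = R t"
    if st: "0 \<le> s" "s \<le> t" "t \<le> b'" and pos: "\<And>u. u \<in> {s..t} \<Longrightarrow> f u + c' u - d' u \<noteq> 0" for s t
  proof (rule ccontr)
    assume "R s \<noteq> R t"
    moreover have mono: "R u \<le> R v" if "0 \<le> u" "u \<le> v" "v \<le> b'" for u v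
      using R(2) that by (auto simp: mono_on_def)
    ultimately have less: "R s < R t" using st by (simp add: order_less_le)
    obtain u where u: "u \<in> {0..t}" "e u = R t" using R_eq[of t] st by auto
    have "s < u"
      using mono[of u s] R_ge[of u] u st less by (cases "s < u") auto
    have "e u \<noteq> 0" using R_nonneg[of s] less u st by auto
    then have "b < u" using e0[of u] by linarith
    moreover have "R t = f b - f u - x"
      using \<open>e u \<noteq> 0\<close> \<open>b < u\<close> u by (auto simp: e_def max_def split: if_splits)
    moreover have "R u = R t" using R_ge[of u] mono[of u t] u st by auto
    ultimately show False using pos[of u] new[of u] u \<open>s < u\<close> by auto
  qed
  have "c' 0 = 0" "d' 0 = 0"
    using refl b R0[of 0] by (simp_all add: reflects_upto_def c'_def d'_def)
  moreover have "mono_on {0..b'} c'" "mono_on {0..b'} d'"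
    using refl R(2) b unfolding reflects_upto_def mono_on_def c'_def d'_def
    by (auto intro!: add_mono)
  moreover have "continuous_on {0..b'} c'" "continuous_on {0..b'} d'"
    unfolding c'_def d'_def using cont R(1) by (auto intro: continuous_on_add)
  moreover have "c' s = c' t"
    if "0 \<le> s" "s \<le> t" "t \<le> b'" "\<forall>u\<in>{s..t}. f u + c' u - d' u \<noteq> 0" for s t
    using flat_c[of s t] flat_R[of s t] that by (simp add: c'_def)
  ultimately have "reflects_upto h f b' c' d'"
    unfolding reflects_upto_def using range flat_d by blast
  then show ?thesis by blast
qed

lemma reflects_upto_extend:
  assumes f: "continuous_on {0..b'} f" and b: "0 \<le> b" "b \<le> b'" and h: "0 < h"
    and osc: "\<And>s t. s \<in> {b..b'} \<Longrightarrow> t \<in> {b..b'} \<Longrightarrow> f s - f t \<le> h / 2"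
    and refl: "reflects_upto h f b c d"
  shows "\<exists>c' d'. reflects_upto h f b' c' d'"
proof (cases "f b + c b - d b \<le> h / 2")
  case True
  then show ?thesis using reflects_upto_extend_low[OF assms] by blast
next
  case False
  have "\<exists>d' c'. reflects_upto h (\<lambda>t. h - f t) b' d' c'"
  proof (rule reflects_upto_extend_low[OF _ b h])
    show "continuous_on {0..b'} (\<lambda>t. h - f t)" using f by (intro continuous_intros)
    show "reflects_upto h (\<lambda>t. h - f t) b d c" using refl reflects_upto_swap by blast
    show "h - f s - (h - f t) \<le> h / 2" if "s \<in> {b..b'}" "t \<in> {b..b'}" for s t
      using osc[of t s] that by simp
    show "h - f b + d b - c b \<le> h / 2" using False by simp
  qed
  then show ?thesis using reflects_upto_swap by blast
qed

text \<open>
  The grid step \<open>\<delta> / 2\<close> keeps two times of the same cell strictly closer than the modulus \<open>\<delta>\<close> of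
  uniform continuity.
\<close>

lemma reflects_upto_exists:
  assumes f: "continuous_on {0..B} f" and "f 0 \<in> {0..h}" and B: "0 \<le> B" and h: "0 < h"
  shows "\<exists>c d. reflects_upto h f B c d"
proof -
  have "uniformly_continuous_on {0..B} f"
    using f by (intro compact_uniformly_continuous) auto
  moreover have "0 < h / 2" using h by simp
  ultimately obtain \<delta> where \<delta>: "0 < \<delta>"
      and unif: "\<And>s t. s \<in> {0..B} \<Longrightarrow> t \<in> {0..B} \<Longrightarrow> dist s t < \<delta> \<Longrightarrow> dist (f s) (f t) < h / 2"
    unfolding uniformly_continuous_on_def by metis
  have "\<exists>c d. reflects_upto h f (min B (real k * (\<delta> / 2))) c d" for k
  proof (induction k)
    case 0
    have "reflects_upto h f 0 (\<lambda>_. 0) (\<lambda>_. 0)"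
      using assms(2) by (auto simp: reflects_upto_def mono_on_def)
    then show ?case using B by (auto simp: min_absorb2)
  next
    case (Suc k)
    let ?b = "min B (real k * (\<delta> / 2))" and ?b' = "min B (real (Suc k) * (\<delta> / 2))"
    have "?b' - ?b \<le> \<delta> / 2" "?b \<le> ?b'" "0 \<le> ?b"
      using \<delta> B by (auto simp: field_simps min_def)
    moreover have "continuous_on {0..?b'} f"
      using f by (rule continuous_on_subset) auto
    moreover have "f s - f t \<le> h / 2" if "s \<in> {?b..?b'}" "t \<in> {?b..?b'}" for s t
    proof -
      have "dist s t < \<delta>"
        using that \<open>?b' - ?b \<le> \<delta> / 2\<close> \<delta> unfolding dist_real_def atLeastAtMost_iff by linarith
      moreover have "0 \<le> s" "0 \<le> t"
        using that \<open>0 \<le> ?b\<close> unfolding atLeastAtMost_iff by linarith+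
      ultimately have "dist (f s) (f t) < h / 2" using unif[of s t] that by simp
      then show ?thesis unfolding dist_real_def by linarith
    qed
    ultimately show ?case using Suc.IH reflects_upto_extend[OF _ _ _ h] by blast
  qed
  moreover obtain k where "B / (\<delta> / 2) < real k" using reals_Archimedean2 by blast
  then have "min B (real k * (\<delta> / 2)) = B" using \<delta> by (simp add: field_simps)
  ultimately show ?thesis by metis
qed

lemma skorohod_pair_exists:
  assumes f: "f \<in> C0_plus" and h: "0 < h"
  shows "\<exists>c0 ch. skorohod_pair h f c0 ch"
proof -
  note cont = C0_plusD(1)[OF f]
  obtain B where B: "0 \<le> B" "\<And>t. B \<le> t \<Longrightarrow> f t = 0" using C0_plusD(4)[OF f] by blast
  have "continuous_on {0..B} f" using cont by (rule continuous_on_subset) auto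
  then obtain c d where refl: "reflects_upto h f B c d"
    using reflects_upto_exists[of B f h] C0_plusD(3)[OF f] B(1) h by auto
  define c0 where "c0 t = c (min B t)" for t
  define d0 where "d0 t = d (min B t)" for t
  have val: "f t + c0 t - d0 t = f (min B t) + c (min B t) - d (min B t)" for t
    using B(2)[of B] B(2)[of t] by (cases "B \<le> t") (auto simp: c0_def d0_def min_def)
  have cont': "continuous_on {0..} c0" "continuous_on {0..} d0"
    unfolding c0_def d0_def using refl B(1) unfolding reflects_upto_def
    by (auto intro!: continuous_intros elim!: continuous_on_compose2)
  have mono: "mono_on {0..} c0" "mono_on {0..} d0"
    using refl B(1) unfolding reflects_upto_def mono_on_def c0_def d0_def by auto
  have L: "continuous_on {0..} (\<lambda>t. f t + c0 t - d0 t)"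
    using cont cont' by (intro continuous_intros)
  have off: "\<forall>u\<in>{min B s..min B t}. f u + c u - d u \<noteq> a"
    if "\<And>u. u \<in> {s..t} \<Longrightarrow> f u + c0 u - d0 u \<noteq> a" "s \<le> t" for s t a
  proof
    fix u assume u: "u \<in> {min B s..min B t}"
    show "f u + c u - d u \<noteq> a"
    proof (cases "s \<le> B")
      case True
      then show ?thesis using that(1)[of u] val[of u] u by (auto simp: min_def split: if_splits)
    next
      case False
      then have "u = min B s" using u that(2) by auto
      then show ?thesis using that(1)[of s] val[of s] that(2) by auto
    qed
  qed
  have "c0 s = c0 t" if "0 \<le> s" "s \<le> t" "\<And>u. u \<in> {s..t} \<Longrightarrow> f u + c0 u - d0 u \<noteq> 0" for s t
    using off[OF that(3,2)] refl that(1,2) B(1) unfolding c0_def reflects_upto_def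
    by (metis min.bounded_iff min.cobounded1 min.mono order_refl)
  then have supp_c: "measure_support (stieltjes c0) \<subseteq> {t. 0 \<le> t \<and> f t + c0 t - d0 t = 0}"
    by (rule support_if_const_off[OF cont'(1) mono(1) L])
  have "d0 s = d0 t" if "0 \<le> s" "s \<le> t" "\<And>u. u \<in> {s..t} \<Longrightarrow> f u + c0 u - d0 u \<noteq> h" for s t
    using off[OF that(3,2)] refl that(1,2) B(1) unfolding d0_def reflects_upto_def
    by (metis min.bounded_iff min.cobounded1 min.mono order_refl)
  then have supp_d: "measure_support (stieltjes d0) \<subseteq> {t. 0 \<le> t \<and> f t + c0 t - d0 t = h}"
    by (rule support_if_const_off[OF cont'(2) mono(2) L])
  have range: "f t + c0 t - d0 t \<in> {0..h}" if "0 \<le> t" for t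
    using refl that B(1) unfolding val by (simp add: reflects_upto_def)
  have "c0 0 = 0" "d0 0 = 0" using refl B(1) by (simp_all add: reflects_upto_def c0_def d0_def)
  then have "skorohod_pair h f c0 (\<lambda>t. - d0 t)"
    unfolding skorohod_pair_def
    using cont' mono range supp_c supp_d
    by (auto intro: continuous_on_minus simp: mono_on_def monotone_on_def)
  then show ?thesis by blast
qed

section \<open>The cut function codes the trimmed tree\<close>

text \<open>
  A rise from \<open>s\<close> to \<open>t\<close> would, by the intermediate value theorem, include a rise between two interior
  times. This is how the behaviour of \<open>g\<close> on open intervals extends to their endpoints, where
  \<open>L\<close> may well touch the barrier.
\<close>

lemma antimono_closure:
  fixes g :: "real \<Rightarrow> real"
  assumes g: "continuous_on {s..t} g" and "s \<le> t"
    and dec: "\<And>a b. s < a \<Longrightarrow> a \<le> b \<Longrightarrow> b < t \<Longrightarrow> g b \<le> g a"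
  shows "g t \<le> g s"
proof (rule ccontr)
  assume "\<not> g t \<le> g s"
  then obtain y z where yz: "g s < y" "y < z" "z < g t"
    using dense[of "g s" "g t"] dense by (metis not_le)
  have "\<exists>a\<ge>s. a \<le> t \<and> g a = y"
    using yz g \<open>s \<le> t\<close> by (intro IVT') auto
  then obtain a where a: "s \<le> a" "a \<le> t" "g a = y" by blast
  have "\<exists>b\<ge>a. b \<le> t \<and> g b = z"
    using yz a by (intro IVT' continuous_on_subset[OF g]) auto
  then obtain b where b: "a \<le> b" "b \<le> t" "g b = z" by blast
  have "s \<noteq> a" "b \<noteq> t" using yz a b by auto
  then show False using dec[of a b] a b yz by auto
qed

locale cut =
  fixes h :: real and f :: "real \<Rightarrow> real"
  assumes h_pos: "0 < h" and f: "f \<in> C0_plus"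
begin

abbreviation g :: "real \<Rightarrow> real" where "g \<equiv> h_cut h f"
abbreviation L :: "real \<Rightarrow> real" where "L \<equiv> reflected h f"

lemmas cont_f = C0_plusD(1)[OF f]
lemmas f_nonneg = C0_plusD(2)[OF f]

lemma pair: "skorohod_pair h f (fst (skorohod h f)) (snd (skorohod h f))"
  unfolding skorohod_def using skorohod_pair_exists[OF f h_pos]
  by (metis (mono_tags, lifting) fst_conv snd_conv someI_ex)

lemma f_eq: "f t = g t + L t"
  by (simp add: h_cut_def)

lemma L_range: "0 \<le> t \<Longrightarrow> 0 \<le> L t \<and> L t \<le> h"
  using pair by (simp add: skorohod_pair_def reflected_def)

lemma L_0: "L 0 = 0"
  using pair C0_plusD(3)[OF f] by (simp add: skorohod_pair_def reflected_def)

lemma g_0: "g 0 = 0"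
  by (simp add: h_cut_def L_0 C0_plusD(3)[OF f])

lemma cont_L: "continuous_on {0..} L"
  using pair cont_f unfolding skorohod_pair_def reflected_def[abs_def]
  by (intro continuous_on_add) auto

lemma cont_g: "continuous_on {0..} g"
  unfolding h_cut_def[abs_def] using cont_f cont_L by (intro continuous_on_diff)

lemma g_le_f: "0 \<le> t \<Longrightarrow> g t \<le> f t"
  using f_eq[of t] L_range[of t] by simp

text \<open>
  Since \<open>g = - c0 - ch\<close> with \<open>c0\<close> non-decreasing and constant off the zeros of \<open>L\<close>, and \<open>ch\<close>
  non-increasing and constant where \<open>L\<close> avoids \<open>h\<close>, the function \<open>g\<close> goes down only on the zeros
  of \<open>L\<close> and up only where \<open>L = h\<close>.
\<close>

lemma g_up_if_L_pos:
  assumes "0 \<le> s" "s \<le> t" "\<And>u. s < u \<Longrightarrow> u < t \<Longrightarrow> L u \<noteq> 0"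
  shows "g s \<le> g t"
proof -
  let ?c = "fst (skorohod h f)" and ?d = "\<lambda>t. - snd (skorohod h f) t"
  have g_eq: "g = (\<lambda>t. ?d t - ?c t)" by (simp add: h_cut_def reflected_def fun_eq_iff)
  have c: "continuous_on {0..} ?c" "mono_on {0..} ?c" "mono_on {0..} ?d"
      "measure_support (stieltjes ?c) \<subseteq> {t. 0 \<le> t \<and> L t = 0}"
    using pair by (auto simp: skorohod_pair_def reflected_def monotone_on_def)
  have "- g t \<le> - g s"
  proof (rule antimono_closure[OF _ \<open>s \<le> t\<close>])
    show "continuous_on {s..t} (\<lambda>t. - g t)"
      using assms(1) by (intro continuous_on_minus continuous_on_subset[OF cont_g]) auto
    fix a b assume ab: "s < a" "a \<le> b" "b < t"
    have "?c a = ?c b"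
      by (rule const_off_support[OF c(1,2,4)]) (use ab assms in auto)
    moreover have "?d a \<le> ?d b" using c(3) ab assms(1) by (auto simp: monotone_on_def)
    ultimately show "- g b \<le> - g a" unfolding g_eq by simp
  qed
  then show ?thesis by simp
qed

lemma g_down_if_L_less:
  assumes "0 \<le> s" "s \<le> t" "\<And>u. s < u \<Longrightarrow> u < t \<Longrightarrow> L u \<noteq> h"
  shows "g t \<le> g s"
proof (rule antimono_closure[OF _ \<open>s \<le> t\<close>])
  let ?c = "fst (skorohod h f)" and ?d = "\<lambda>t. - snd (skorohod h f) t"
  have g_eq: "g = (\<lambda>t. ?d t - ?c t)" by (simp add: h_cut_def reflected_def fun_eq_iff)
  have d: "continuous_on {0..} ?d" "mono_on {0..} ?d" "mono_on {0..} ?c"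
      "measure_support (stieltjes ?d) \<subseteq> {t. 0 \<le> t \<and> L t = h}"
    using pair by (auto simp: skorohod_pair_def reflected_def monotone_on_def intro: continuous_on_minus)
  show "continuous_on {s..t} g"
    using assms(1) by (intro continuous_on_subset[OF cont_g]) auto
  fix a b assume ab: "s < a" "a \<le> b" "b < t"
  have "?d a = ?d b"
    by (rule const_off_support[OF d(1,2,4)]) (use ab assms in auto)
  moreover have "?c a \<le> ?c b" using d(3) ab assms(1) by (auto simp: monotone_on_def)
  ultimately show "g b \<le> g a" unfolding g_eq by simp
qed

text \<open>
  While \<open>g\<close> is below \<open>c\<close> and \<open>f\<close> is not, \<open>L\<close> is positive and \<open>g\<close> does not go down; so \<open>g\<close> cannot
  pass below a level \<open>c\<close> that \<open>f\<close> stays above.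
\<close>

lemma level_preserved:
  assumes st: "0 \<le> s" "s \<le> t" and s: "c \<le> g s" and above: "\<And>v. v \<in> {s..t} \<Longrightarrow> c \<le> f v"
  shows "c \<le> g t"
proof (rule ccontr)
  assume "\<not> c \<le> g t"
  then obtain y where y: "g t < y" "y < c" using dense by (metis not_le)
  have "continuous_on {s..t} (\<lambda>u. - g u)"
    using st by (intro continuous_on_minus continuous_on_subset[OF cont_g]) auto
  then obtain u where u: "s \<le> u" "u \<le> t" "- g u = - y" "\<And>v. u \<le> v \<Longrightarrow> v \<le> t \<Longrightarrow> - y \<le> - g v"
    by (rule last_visit[of s t "\<lambda>u. - g u" "- y"]) (use st s y in auto)
  have "g u \<le> g t"
  proof (rule g_up_if_L_pos)
    fix v assume "u < v" "v < t"
    then show "L v \<noteq> 0" using u(4)[of v] u(1) above[of v] f_eq[of v] y(2) by force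
  qed (use st u in auto)
  then show False using u(3) y by simp
qed

lemma g_nonneg: "0 \<le> t \<Longrightarrow> 0 \<le> g t"
  using level_preserved[of 0 t 0] f_nonneg g_0 by simp

lemma le_g_between_iff:
  assumes "0 \<le> s" "0 \<le> t"
  shows "(\<forall>v\<in>betw s t. c \<le> g v) \<longleftrightarrow> c \<le> g s \<and> c \<le> g t \<and> (\<forall>v\<in>betw s t. c \<le> f v)"
proof (intro iffI conjI ballI)
  assume *: "\<forall>v\<in>betw s t. c \<le> g v"
  show "c \<le> g s" "c \<le> g t" using * by auto
  show "c \<le> f v" if "v \<in> betw s t" for v
    using * g_le_f[of v] that assms by force
next
  fix v assume *: "c \<le> g s \<and> c \<le> g t \<and> (\<forall>v\<in>betw s t. c \<le> f v)" and v: "v \<in> betw s t"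
  show "c \<le> g v"
  proof (cases "s \<le> t")
    case True
    then show ?thesis using * v assms by (intro level_preserved[of s v]) auto
  next
    case False
    then show ?thesis using * v assms by (intro level_preserved[of t v]) auto
  qed
qed

text \<open>
  A time \<open>a\<close> is a foot of \<open>s\<close> if it codes, in the tree of \<open>f\<close>, the ancestor at height \<open>g s\<close> of the
  point coded by \<open>s\<close>.
\<close>

definition is_foot :: "real \<Rightarrow> real \<Rightarrow> bool" where
  "is_foot a s \<longleftrightarrow> 0 \<le> a \<and> f a = g s \<and> (\<forall>v\<in>betw a s. g s \<le> f v)"

lemma foot_exists:
  assumes "0 \<le> s"
  shows "\<exists>a. is_foot a s \<and> a \<le> s"
proof -
  have "continuous_on {0..s} f" by (rule continuous_on_subset[OF cont_f]) auto
  then obtain a where a: "0 \<le> a" "a \<le> s" "f a = g s" "\<And>v. a \<le> v \<Longrightarrow> v \<le> s \<Longrightarrow> g s \<le> f v"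
    by (rule last_visit[of 0 s f "g s"])
      (use assms g_nonneg g_le_f C0_plusD(3)[OF f] in auto)
  then show ?thesis by (auto simp: is_foot_def intro!: exI[of _ a])
qed

text \<open>
  The heart of the argument: taking feet carries the pseudo-distance of \<open>g\<close> to that of \<open>f\<close>, because
  \<open>f\<close> between two feet and \<open>g\<close> between the original times stay above the same levels.
\<close>

lemma code_dist_foot:
  assumes a: "is_foot a s" and b: "is_foot b t" and st: "0 \<le> s" "0 \<le> t"
  shows "code_dist f a b = code_dist g s t"
proof -
  have ab: "0 \<le> a" "0 \<le> b" using a b by (auto simp: is_foot_def)
  have "(\<forall>v\<in>betw a b. c \<le> f v) \<longleftrightarrow> (\<forall>v\<in>betw s t. c \<le> g v)" for c
    unfolding le_g_between_iff[OF st]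
  proof (intro iffI conjI ballI)
    assume *: "\<forall>v\<in>betw a b. c \<le> f v"
    have "c \<le> f a" "c \<le> f b" using * by auto
    then show "c \<le> g s" "c \<le> g t" using a b by (simp_all add: is_foot_def)
    fix v assume "v \<in> betw s t"
    then have "v \<in> betw a b \<or> v \<in> betw a s \<or> v \<in> betw b t" by auto
    then show "c \<le> f v"
      using * a b \<open>c \<le> g s\<close> \<open>c \<le> g t\<close> unfolding is_foot_def by (meson order_trans)
  next
    fix v assume *: "c \<le> g s \<and> c \<le> g t \<and> (\<forall>v\<in>betw s t. c \<le> f v)" and "v \<in> betw a b"
    then have "v \<in> betw s t \<or> v \<in> betw a s \<or> v \<in> betw b t" by auto
    then show "c \<le> f v"
      using * a b unfolding is_foot_def by (meson order_trans)
  qed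
  then have "c \<le> (INF v\<in>betw a b. f v) \<longleftrightarrow> c \<le> (INF v\<in>betw s t. g v)" for c
    using le_inf_iff[OF cont_f ab] le_inf_iff[OF cont_g st] by simp
  then have "(INF v\<in>betw a b. f v) = (INF v\<in>betw s t. g v)"
    by (meson order_antisym order_refl)
  then show ?thesis using a b by (simp add: code_dist_def is_foot_def)
qed

definition node :: "real \<Rightarrow> real set" where
  "node s = tree_proj f (SOME a. is_foot a s \<and> a \<le> s)"

lemma node_eq:
  assumes "0 \<le> s"
  obtains a where "is_foot a s" "a \<le> s" "0 \<le> a" "node s = tree_proj f a"
  using someI_ex[OF foot_exists[OF assms]] that unfolding node_def is_foot_def by blast

lemma tree_dist_node:
  assumes "0 \<le> s" "0 \<le> t"
  shows "tree_dist f (node s) (node t) = code_dist g s t"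
proof -
  obtain a b where "is_foot a s" "0 \<le> a" "node s = tree_proj f a"
      "is_foot b t" "0 \<le> b" "node t = tree_proj f b"
    using node_eq assms by metis
  then show ?thesis using code_dist_foot assms tree_dist_proj[OF cont_f] by simp
qed

lemma node_eq_iff:
  assumes "0 \<le> s" "0 \<le> t"
  shows "node s = node t \<longleftrightarrow> code_dist g s t = 0"
proof -
  obtain a b where "is_foot a s" "0 \<le> a" "node s = tree_proj f a"
      "is_foot b t" "0 \<le> b" "node t = tree_proj f b"
    using node_eq assms by metis
  then show ?thesis using code_dist_foot[of a s b t] assms tree_proj_eq_iff[OF cont_f, of a b] by simp
qed

lemma node_0: "node 0 = tree_root f"
proof -
  obtain a where "a \<le> 0" "0 \<le> a" "node 0 = tree_proj f a" using node_eq[of 0] by auto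
  then show ?thesis by (simp add: tree_root_def)
qed

text \<open>
  A point of the tree of \<open>g\<close> survives the trimming since the latest time \<open>w\<close> with \<open>L w = h\<close> codes a
  descendant at distance at least \<open>h\<close>; before the first such time \<open>g\<close> vanishes. Conversely, if \<open>r\<close>
  has a descendant \<open>v\<close> at distance at least \<open>h\<close>, then \<open>g r \<le> f r \<le> g v\<close>, so \<open>g\<close> takes the value \<open>f r\<close>
  in between.
\<close>

lemma node_in_trimming:
  assumes s: "0 \<le> s" and ne: "trimming h f \<noteq> {}"
  shows "node s \<in> trimming h f"
proof (cases "\<exists>w\<in>{0..s}. L w = h")
  case True
  then obtain w where "w \<in> {0..s}" "L w = h" by blast
  moreover have "continuous_on {0..s} L" by (rule continuous_on_subset[OF cont_L]) auto
  ultimately obtain w where w: "0 \<le> w" "w \<le> s" "L w = h" "\<And>u. w < u \<Longrightarrow> u \<le> s \<Longrightarrow> L u \<noteq> h"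
    using last_time by blast
  have above: "g s \<le> g v" if v: "v \<in> {w..s}" for v
    by (rule g_down_if_L_less) (use v w in auto)
  obtain a where a: "is_foot a s" "a \<le> s" "0 \<le> a" "node s = tree_proj f a"
    using node_eq[OF s] by blast
  have "f a + h \<le> f w"
    using above[of w] w a(1) f_eq[of w] by (auto simp: is_foot_def)
  moreover have "f a \<le> f v" if v: "v \<in> betw a w" for v
  proof (cases "v \<le> s \<and> a \<le> v")
    case True
    then show ?thesis using a by (auto simp: is_foot_def)
  next
    case False
    then have "v \<in> {w..s}" using v w(2) a(2) by (auto simp: min_def max_def split: if_splits)
    then show ?thesis using above[of v] g_le_f[of v] w(1) a(1) by (auto simp: is_foot_def)
  qed
  ultimately show ?thesis
    using proj_in_trimming_iff[OF f a(3) h_pos] a(4) w(1) by auto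
next
  case False
  then have "g s \<le> g 0" using s by (intro g_down_if_L_less) auto
  then have "g s = 0" using g_nonneg[OF s] g_0 by simp
  moreover have "\<forall>v\<in>betw s 0. 0 \<le> g v"
    using s by (auto intro: g_nonneg)
  ultimately have "code_dist g s 0 = 0"
    unfolding code_dist_eq_0_iff[OF cont_g s order_refl] by (simp add: g_0)
  then have "node s = tree_proj f 0"
    using node_eq_iff[OF s, of 0] node_0 by (simp add: tree_root_def)
  moreover obtain r where r: "0 \<le> r" "tree_proj f r \<in> trimming h f"
    using ne by (auto simp: trimming_def coded_tree_eq)
  then obtain v where v: "0 \<le> v" "f r + h \<le> f v"
    using proj_in_trimming_iff[OF f _ h_pos] by blast
  have "tree_proj f 0 \<in> trimming h f"
    unfolding proj_in_trimming_iff[OF f order_refl h_pos] C0_plusD(3)[OF f]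
    using v f_nonneg[OF r(1)] by (intro exI[of _ v]) (auto intro: f_nonneg)
  ultimately show ?thesis by simp
qed

lemma trimming_subset_nodes:
  assumes "x \<in> trimming h f"
  obtains s where "0 \<le> s" "x = node s"
proof -
  obtain r where r: "0 \<le> r" "x = tree_proj f r"
    using assms by (auto simp: trimming_def coded_tree_eq)
  then obtain v where v: "0 \<le> v" "f r + h \<le> f v" "\<forall>u\<in>betw r v. f r \<le> f u"
    using proj_in_trimming_iff[OF f _ h_pos] assms by blast
  have "connected (g ` betw r v)"
    by (intro connected_continuous_image continuous_on_subset[OF cont_g]) (use r v in auto)
  moreover have "g r \<le> f r" "f r \<le> g v"
    using g_le_f[OF r(1)] v(2) f_eq[of v] L_range[OF v(1)] by auto
  ultimately have "f r \<in> g ` betw r v"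
    using connectedD_interval[of "g ` betw r v" "g r" "g v" "f r"] by auto
  then obtain s where s: "s \<in> betw r v" "g s = f r" by auto
  then have s0: "0 \<le> s" using r v by auto
  have "is_foot r s"
    unfolding is_foot_def
  proof (intro conjI ballI)
    fix u assume "u \<in> betw r s"
    then have "u \<in> betw r v" using s(1) by auto
    then show "g s \<le> f u" using s(2) v(3) by simp
  qed (use r s in auto)
  moreover obtain a where a: "is_foot a s" "0 \<le> a" "node s = tree_proj f a"
    using node_eq[OF s0] by blast
  ultimately have "x = node s"
    using code_dist_foot[of r s a s] s0 r tree_proj_eq_iff[OF cont_f, of r a] by simp
  then show thesis using that s0 by blast
qed

lemma trimming_eq_nodes:
  assumes "trimming h f \<noteq> {}"
  shows "trimming h f = node ` {0..}"
  using node_in_trimming[OF _ assms] by (auto elim: trimming_subset_nodes)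

end

section \<open>The tree of a piecewise monotone function\<close>

text \<open>
  A non-negative function that goes down on each \<open>[peak n, valley (n + 1)]\<close>, up on each
  \<open>[valley (n + 1), peak (n + 1)]\<close>, and down after the last peak. It is explored from one peak to the
  next: the descent prescribes the grafting point, the ascent is the new branch.
\<close>

locale zigzag =
  fixes g :: "real \<Rightarrow> real" and N :: nat and peak valley X Y :: "nat \<Rightarrow> real"
  assumes cont: "continuous_on {0..} g" and nonneg: "0 \<le> t \<Longrightarrow> 0 \<le> g t" and g_0: "g 0 = 0"
    and N_pos: "1 \<le> N" and peak_0: "peak 0 = 0"
    and ordered: "n < N \<Longrightarrow> peak n \<le> valley (Suc n) \<and> valley (Suc n) \<le> peak (Suc n)"
    and descent: "n < N \<Longrightarrow> peak n \<le> a \<Longrightarrow> a \<le> b \<Longrightarrow> b \<le> valley (Suc n) \<Longrightarrow> g b \<le> g a"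
    and ascent: "n < N \<Longrightarrow> valley (Suc n) \<le> a \<Longrightarrow> a \<le> b \<Longrightarrow> b \<le> peak (Suc n) \<Longrightarrow> g a \<le> g b"
    and final_descent: "peak N \<le> a \<Longrightarrow> a \<le> b \<Longrightarrow> g b \<le> g a"
    and X: "n < N \<Longrightarrow> X (Suc n) = g (peak (Suc n)) - g (valley (Suc n))"
    and Y: "n < N \<Longrightarrow> Y (Suc n) = g (peak n) - g (valley (Suc n))"
begin

lemma peak_nonneg: "n \<le> N \<Longrightarrow> 0 \<le> peak n"
proof (induction n)
  case (Suc n)
  then show ?case using ordered[of n] by simp
qed (simp add: peak_0)

lemma X_nonneg: "n < N \<Longrightarrow> 0 \<le> X (Suc n)"
  using X[of n] ascent[of n "valley (Suc n)" "peak (Suc n)"] ordered[of n] by simp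

lemma valley_le: "n < N \<Longrightarrow> g (valley (Suc n)) \<le> g (peak n)"
  using descent[of n "peak n" "valley (Suc n)"] ordered[of n] by simp

lemma code_dist_on_branch:
  assumes n: "n < N" and "u \<in> {valley (Suc n)..peak (Suc n)}" "v \<in> {valley (Suc n)..peak (Suc n)}"
  shows "code_dist g u v = \<bar>g u - g v\<bar>"
proof -
  have *: "code_dist g u v = g v - g u \<and> g u \<le> g v"
    if "valley (Suc n) \<le> u" "u \<le> v" "v \<le> peak (Suc n)" for u v
  proof -
    have "0 \<le> u" using that ordered[OF n] peak_nonneg[of n] n by simp
    moreover have "\<forall>w\<in>betw u v. g u \<le> g w"
      using ascent[OF n] that by auto
    ultimately show ?thesis
      using code_dist_ancestor_iff[OF cont, of u v] that by auto
  qed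
  show ?thesis
  proof (cases "u \<le> v")
    case True
    then show ?thesis using *[of u v] assms by auto
  next
    case False
    then show ?thesis using *[of v u] assms code_dist_commute[of g u v] by auto
  qed
qed

text \<open>Along an ascent the distance to an earlier point only grows by the height climbed.\<close>

lemma code_dist_across:
  assumes n: "n < N" and a: "0 \<le> a" "a \<le> valley (Suc n)" and w: "w \<in> {valley (Suc n)..peak (Suc n)}"
  shows "code_dist g a w = code_dist g a (valley (Suc n)) + (g w - g (valley (Suc n)))"
proof -
  let ?l = "valley (Suc n)"
  have climb: "g ?l \<le> g v" if "v \<in> {?l..w}" for v
    using ascent[OF n, of ?l v] that w by auto
  have "c \<le> (INF v\<in>betw a w. g v) \<longleftrightarrow> c \<le> (INF v\<in>betw a ?l. g v)" for c
  proof -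
    have "(\<forall>v\<in>{a..w}. c \<le> g v) \<longleftrightarrow> (\<forall>v\<in>{a..?l}. c \<le> g v)" (is "?A \<longleftrightarrow> ?B")
    proof
      show "?A \<Longrightarrow> ?B" using w by auto
      assume B: ?B
      then have "c \<le> g ?l" using a by simp
      show ?A
      proof
        fix v assume "v \<in> {a..w}"
        then show "c \<le> g v"
          using B climb[of v] \<open>c \<le> g ?l\<close> by (cases "v \<le> ?l") auto
      qed
    qed
    moreover have "betw a w = {a..w}" "betw a ?l = {a..?l}"
      using a w by (auto simp: min_def max_def)
    ultimately show ?thesis
      using le_inf_iff[OF cont, of a w c] le_inf_iff[OF cont, of a ?l c] a w by simp
  qed
  then have "(INF v\<in>betw a w. g v) = (INF v\<in>betw a ?l. g v)"
    by (meson order_antisym order_refl)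
  then show ?thesis by (simp add: code_dist_def)
qed

text \<open>
  The invariant of the algorithm: \<open>loc\<close> assigns to each point of the current tree a time before
  \<open>peak n\<close> that codes it, every such time is reached up to distance \<open>0\<close>, and the tip is coded
  by \<open>peak n\<close>. The bound on labels keeps the next label fresh.
\<close>

definition coded_upto :: "nat \<Rightarrow> rtree \<Rightarrow> (nat \<times> real \<Rightarrow> real) \<Rightarrow> bool" where
  "coded_upto n T loc \<longleftrightarrow>
     (\<forall>p\<in>points T. loc p \<in> {0..peak n} \<and> fst p \<le> n) \<and>
     (\<forall>p\<in>points T. \<forall>q\<in>points T. rdist T p q = code_dist g (loc p) (loc q)) \<and>
     (\<forall>p\<in>points T. \<forall>q\<in>points T. rdist T p q = 0 \<longrightarrow> p = q) \<and>
     (\<forall>u\<in>{0..peak n}. \<exists>p\<in>points T. code_dist g (loc p) u = 0) \<and>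
     origin T \<in> points T \<and> code_dist g 0 (loc (origin T)) = 0 \<and>
     tip T \<in> points T \<and> code_dist g (loc (tip T)) (peak n) = 0"

lemma coded_uptoD:
  assumes "coded_upto n T loc"
  shows "p \<in> points T \<Longrightarrow> 0 \<le> loc p \<and> loc p \<le> peak n \<and> fst p \<le> n"
    and "p \<in> points T \<Longrightarrow> q \<in> points T \<Longrightarrow> rdist T p q = code_dist g (loc p) (loc q)"
    and "p \<in> points T \<Longrightarrow> q \<in> points T \<Longrightarrow> rdist T p q = 0 \<Longrightarrow> p = q"
    and "0 \<le> u \<Longrightarrow> u \<le> peak n \<Longrightarrow> \<exists>p\<in>points T. code_dist g (loc p) u = 0"
    and "origin T \<in> points T" "code_dist g 0 (loc (origin T)) = 0"
    and "tip T \<in> points T" "code_dist g (loc (tip T)) (peak n) = 0"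
  using assms unfolding coded_upto_def by simp_all

lemma branch_time_exists:
  assumes "n < N" "0 \<le> r" "r \<le> X (Suc n)"
  shows "\<exists>u\<in>{valley (Suc n)..peak (Suc n)}. g u = g (valley (Suc n)) + r"
proof -
  have "continuous_on {valley (Suc n)..peak (Suc n)} g"
    using ordered[OF assms(1)] peak_nonneg[of n] assms(1)
    by (intro continuous_on_subset[OF cont]) auto
  then have "\<exists>u\<ge>valley (Suc n). u \<le> peak (Suc n) \<and> g u = g (valley (Suc n)) + r"
    using X[OF assms(1)] ordered[OF assms(1)] assms by (intro IVT') auto
  then show ?thesis by auto
qed

lemma coded_upto_single_branch: "\<exists>loc. coded_upto 1 (single_branch (X 1)) loc"
proof -
  have N: "0 < N" using N_pos by simp
  have l: "0 \<le> valley 1" "valley 1 \<le> peak 1" using ordered[OF N] peak_0 by auto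
  have ground: "g u = 0" if "0 \<le> u" "u \<le> valley 1" for u
    using descent[OF N, of 0 u] nonneg[of u] g_0 that peak_0 by simp
  have X1: "X 1 = g (peak 1)" using X[OF N] ground[of "valley 1"] l by simp
  define b where "b r = (SOME u. u \<in> {valley 1..peak 1} \<and> g u = r)" for r
  have b: "b r \<in> {valley 1..peak 1}" "g (b r) = r" if "0 \<le> r" "r \<le> X 1" for r
  proof -
    have "\<exists>u. u \<in> {valley 1..peak 1} \<and> g u = r"
      using branch_time_exists[OF N, of r] that ground[of "valley 1"] l by auto
    then have "b r \<in> {valley 1..peak 1} \<and> g (b r) = r"
      unfolding b_def by (rule someI_ex)
    then show "b r \<in> {valley 1..peak 1}" "g (b r) = r" by auto
  qed
  have dist: "code_dist g u v = \<bar>g u - g v\<bar>" if "u \<in> {valley 1..peak 1}" "v \<in> {valley 1..peak 1}" for u v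
    using code_dist_on_branch[OF N] that by simp
  have X1_nonneg: "0 \<le> X 1" using X_nonneg[OF N] by simp
  have cover: "\<exists>p\<in>{1::nat} \<times> {0..X 1}. code_dist g (b (snd p)) u = 0" if u: "0 \<le> u" "u \<le> peak 1" for u
  proof (cases "u \<le> valley 1")
    case True
    have b0: "0 \<le> b 0" "g (b 0) = 0" using b[of 0] X1_nonneg l by auto
    have "\<forall>v\<in>betw (b 0) u. 0 \<le> g v"
      using b0(1) u(1) by (intro ballI nonneg) auto
    then have "code_dist g (b 0) u = 0"
      unfolding code_dist_eq_0_iff[OF cont b0(1) u(1)] by (simp add: b0(2) ground[OF u(1) True])
    then show ?thesis using X1_nonneg by (intro bexI[of _ "(1, 0)"]) auto
  next
    case False
    then have "0 \<le> g u" "g u \<le> X 1"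
      using nonneg[OF u(1)] ascent[OF N, of u "peak 1"] u X1 by auto
    then show ?thesis
      using b[of "g u"] dist[of "b (g u)" u] False u by (intro bexI[of _ "(1, g u)"]) auto
  qed
  have origin: "code_dist g 0 (b 0) = 0"
    using code_dist_root[OF cont nonneg g_0, of "b 0"] b[of 0] X1_nonneg l by simp
  have tip: "code_dist g (b (X 1)) (peak 1) = 0"
    using dist[of "b (X 1)" "peak 1"] b[of "X 1"] X1_nonneg X1 l by simp
  let ?T = "single_branch (X 1)"
  have T: "points ?T = {1} \<times> {0..X 1}" "origin ?T = (1, 0)" "tip ?T = (1, X 1)"
    "rdist ?T p q = \<bar>snd p - snd q\<bar>" for p q
    by (simp_all add: single_branch_def)
  have "coded_upto 1 ?T (\<lambda>p. b (snd p))"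
    unfolding coded_upto_def T
  proof (intro conjI ballI impI)
    fix p :: "nat \<times> real" assume p: "p \<in> {1} \<times> {0..X 1}"
    then have bp: "b (snd p) \<in> {valley 1..peak 1}" "g (b (snd p)) = snd p" using b by auto
    show "b (snd p) \<in> {0..peak 1}" "fst p \<le> 1" using bp(1) l p by auto
    fix q :: "nat \<times> real" assume q: "q \<in> {1} \<times> {0..X 1}"
    then have bq: "b (snd q) \<in> {valley 1..peak 1}" "g (b (snd q)) = snd q" using b by auto
    show "\<bar>snd p - snd q\<bar> = code_dist g (b (snd p)) (b (snd q))"
      using dist[OF bp(1) bq(1)] bp(2) bq(2) by simp
    show "p = q" if "\<bar>snd p - snd q\<bar> = 0" using that p q by (auto simp: prod_eq_iff)
  qed (use cover origin tip X1_nonneg in auto)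
  then show ?thesis by blast
qed

lemma coded_upto_descent:
  assumes C: "coded_upto n T loc" and n: "n \<le> N" and u: "peak n \<le> u"
    and down: "\<And>v. peak n \<le> v \<Longrightarrow> v \<le> u \<Longrightarrow> g u \<le> g v"
  shows "\<exists>p\<in>points T. code_dist g (loc p) u = 0"
proof -
  have t: "0 \<le> peak n" using peak_nonneg n by simp
  have "continuous_on {0..peak n} g" by (rule continuous_on_subset[OF cont]) auto
  then obtain w where w: "0 \<le> w" "w \<le> peak n" "g w = g u" "\<And>v. w \<le> v \<Longrightarrow> v \<le> peak n \<Longrightarrow> g u \<le> g v"
    by (rule last_visit[of 0 "peak n" g "g u"])
      (use t g_0 nonneg[of u] down[of "peak n"] u in auto)
  obtain p where p: "p \<in> points T" "code_dist g (loc p) w = 0" "0 \<le> loc p"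
    using coded_uptoD(4)[OF C w(1,2)] coded_uptoD(1)[OF C] by blast
  have u0: "0 \<le> u" using t u by simp
  have "g w \<le> g v" if v: "v \<in> betw w u" for v
  proof (cases "v \<le> peak n")
    case True
    then show ?thesis using w v u by simp
  next
    case False
    then show ?thesis using down[of v] w(2,3) v u by simp
  qed
  then have "code_dist g w u = 0"
    unfolding code_dist_eq_0_iff[OF cont w(1) u0] using w(3) by blast
  then have "code_dist g (loc p) u = 0"
    using code_dist_cong(1)[OF cont p(3) w(1) u0 p(2)] by simp
  then show ?thesis using p(1) by blast
qed

text \<open>
  The grafting point is the ancestor of the tip at the height of the next valley, hence is coded by that
  valley; \<open>code_dist_across\<close> then gives the distances of the grafted tree.
\<close>

lemma coded_upto_graft:
  assumes C: "coded_upto n T loc" and n: "n < N"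
    and p: "p \<in> geodesic (points T) (rdist T) (origin T) (tip T)" "rdist T p (tip T) = Y (Suc n)"
  shows "\<exists>loc'. coded_upto (Suc n) (graft (Suc n) p (X (Suc n)) T) loc'"
proof -
  let ?l = "valley (Suc n)" and ?t = "peak (Suc n)"
  have order: "0 \<le> peak n" "peak n \<le> ?l" "?l \<le> ?t"
    using ordered[OF n] peak_nonneg[of n] n by auto
  have loc: "\<And>q. q \<in> points T \<Longrightarrow> 0 \<le> loc q \<and> loc q \<le> peak n \<and> fst q \<le> n"
    and rd: "\<And>q r. q \<in> points T \<Longrightarrow> r \<in> points T \<Longrightarrow> rdist T q r = code_dist g (loc q) (loc r)"
    and sep: "\<And>q r. q \<in> points T \<Longrightarrow> r \<in> points T \<Longrightarrow> rdist T q r = 0 \<Longrightarrow> q = r"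
    and cover: "\<And>u. 0 \<le> u \<Longrightarrow> u \<le> peak n \<Longrightarrow> \<exists>q\<in>points T. code_dist g (loc q) u = 0"
    and o: "origin T \<in> points T" "code_dist g 0 (loc (origin T)) = 0"
    and z: "tip T \<in> points T" "code_dist g (loc (tip T)) (peak n) = 0"
    using coded_uptoD[OF C] by blast+
  have rd_root: "rdist T (origin T) q = g (loc q)" if "q \<in> points T" for q
  proof -
    have "code_dist g 0 (loc q) = code_dist g (loc (origin T)) (loc q)"
      by (rule code_dist_cong(1)[OF cont]) (use o loc that in auto)
    then show ?thesis
      using rd[OF o(1) that] code_dist_root[OF cont nonneg g_0] loc[OF that] by simp
  qed
  have g_tip: "g (loc (tip T)) = g (peak n)"
    using z loc[OF z(1)] code_dist_eq_0_iff[OF cont] order by blast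
  have rd_tip: "rdist T q (tip T) = code_dist g (loc q) (peak n)" if "q \<in> points T" for q
    using rd[OF that z(1)] code_dist_cong(2)[OF cont _ _ _ z(2)] loc that z order by simp
  obtain \<gamma> r where \<gamma>: "\<gamma> ` {0..rdist T (origin T) (tip T)} \<subseteq> points T"
      "\<gamma> 0 = origin T" "\<gamma> (rdist T (origin T) (tip T)) = tip T"
      "\<forall>s\<in>{0..rdist T (origin T) (tip T)}. \<forall>t\<in>{0..rdist T (origin T) (tip T)}.
         rdist T (\<gamma> s) (\<gamma> t) = \<bar>s - t\<bar>"
      "p = \<gamma> r" "r \<in> {0..rdist T (origin T) (tip T)}"
    using p(1) unfolding geodesic_def by blast
  have pT: "p \<in> points T" using \<gamma> by blast
  have "rdist T (origin T) p + rdist T p (tip T) = rdist T (origin T) (tip T)"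
    using \<gamma>(4)[THEN bspec, of 0, THEN bspec, of r]
      \<gamma>(4)[THEN bspec, of r, THEN bspec, of "rdist T (origin T) (tip T)"] \<gamma>(2,3,5,6) by auto
  then have p_anc: "code_dist g (loc p) (peak n) = g (peak n) - g (loc p)"
    using rd_root[OF pT] rd_root[OF z(1)] rd_tip[OF pT] g_tip by simp
  then have g_p: "g (loc p) = g ?l"
    using p(2) rd_tip[OF pT] Y[OF n] by simp
  have "g (loc p) \<le> g v" if v: "v \<in> betw (loc p) ?l" for v
  proof (cases "v \<le> peak n")
    case True
    then show ?thesis
      using p_anc code_dist_ancestor_iff[OF cont, of "loc p" "peak n"] loc[OF pT] order v by auto
  next
    case False
    then show ?thesis using descent[OF n, of v ?l] g_p v loc[OF pT] order by auto
  qed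
  then have p_low: "code_dist g (loc p) ?l = 0"
    using code_dist_eq_0_iff[OF cont, of "loc p" ?l] g_p loc[OF pT] order by auto
  define b where "b r = (SOME u. u \<in> {?l..?t} \<and> g u = g ?l + r)" for r
  have b: "b r \<in> {?l..?t}" "g (b r) = g ?l + r" if "0 \<le> r" "r \<le> X (Suc n)" for r
  proof -
    have "\<exists>u. u \<in> {?l..?t} \<and> g u = g ?l + r"
      using branch_time_exists[OF n that] by blast
    then have "b r \<in> {?l..?t} \<and> g (b r) = g ?l + r"
      unfolding b_def by (rule someI_ex)
    then show "b r \<in> {?l..?t}" "g (b r) = g ?l + r" by auto
  qed
  have across: "code_dist g (loc q) (b r) = rdist T q p + r"
    if q: "q \<in> points T" and r: "0 \<le> r" "r \<le> X (Suc n)" for q r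
  proof -
    have "code_dist g (loc q) (loc p) = code_dist g (loc q) ?l"
      by (rule code_dist_cong(2)[OF cont _ _ _ p_low]) (use loc[OF q] loc[OF pT] order in auto)
    moreover have "code_dist g (loc q) (b r) = code_dist g (loc q) ?l + r"
      using code_dist_across[OF n, of "loc q" "b r"] b[OF r] loc[OF q] order by simp
    ultimately show ?thesis using rd[OF q pT] by simp
  qed
  have sym: "rdist T q r = rdist T r q" if "q \<in> points T" "r \<in> points T" for q r
    using rd that by (simp add: code_dist_commute)
  have rd_nonneg: "0 \<le> rdist T q p" if "q \<in> points T" for q
    using rd[OF that pT] code_dist_ge[OF cont, of "loc q" "loc p"] loc[OF that] loc[OF pT] by simp
  define T' where "T' = graft (Suc n) p (X (Suc n)) T"
  define loc' where "loc' q = (if fst q = Suc n then b (snd q) else loc q)" for q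
  have points': "points T' = points T \<union> {Suc n} \<times> {0<..X (Suc n)}"
    and origin': "origin T' = origin T"
    and tip': "tip T' = (if X (Suc n) = 0 then p else (Suc n, X (Suc n)))"
    by (simp_all add: T'_def graft_def)
  have rd': "rdist T' u v = (if fst u = Suc n \<and> fst v = Suc n then \<bar>snd u - snd v\<bar>
        else if fst u = Suc n then snd u + rdist T p v
        else if fst v = Suc n then rdist T u p + snd v else rdist T u v)" for u v
    by (simp add: T'_def graft_def)
  have old: "fst q \<noteq> Suc n" "loc' q = loc q" if "q \<in> points T" for q
    using loc[OF that] by (auto simp: loc'_def)
  have new: "loc' (Suc n, r) = b r" for r by (simp add: loc'_def)
  have X0: "0 \<le> X (Suc n)" using X_nonneg[OF n] .
  have points'_cases: thesis if "q \<in> points T'" "q \<in> points T \<Longrightarrow> thesis"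
      "\<And>r. q = (Suc n, r) \<Longrightarrow> 0 < r \<Longrightarrow> r \<le> X (Suc n) \<Longrightarrow> thesis" for q thesis
    using that by (auto simp: points')
  have on_branch: "code_dist g u v = \<bar>g u - g v\<bar>" if "u \<in> {?l..?t}" "v \<in> {?l..?t}" for u v
    using code_dist_on_branch[OF n that] .
  have "loc' q \<in> {0..?t} \<and> fst q \<le> Suc n" if "q \<in> points T'" for q
    using that
  proof (rule points'_cases)
    assume "q \<in> points T"
    then show ?thesis using loc[of q] old[of q] order by auto
  next
    fix r assume "q = (Suc n, r)" "0 < r" "r \<le> X (Suc n)"
    then show ?thesis using b[of r] new[of r] order by auto
  qed
  moreover have "rdist T' q s = code_dist g (loc' q) (loc' s) \<and> (rdist T' q s = 0 \<longrightarrow> q = s)"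
    if qs: "q \<in> points T'" "s \<in> points T'" for q s
    using qs(1)
  proof (rule points'_cases)
    assume q: "q \<in> points T"
    show ?thesis
      using qs(2)
    proof (rule points'_cases)
      assume "s \<in> points T"
      then show ?thesis using q old rd sep by (simp add: rd')
    next
      fix r assume r: "s = (Suc n, r)" "0 < r" "r \<le> X (Suc n)"
      then show ?thesis using across[OF q, of r] rd_nonneg[OF q] old[OF q] new[of r] by (simp add: rd')
    qed
  next
    fix r assume r: "q = (Suc n, r)" "0 < r" "r \<le> X (Suc n)"
    show ?thesis
      using qs(2)
    proof (rule points'_cases)
      assume s: "s \<in> points T"
      then show ?thesis
        using across[OF s, of r] rd_nonneg[OF s] old[OF s] new[of r] r sym[OF pT s]
        by (simp add: rd' code_dist_commute)
    next
      fix r' assume r': "s = (Suc n, r')" "0 < r'" "r' \<le> X (Suc n)"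
      then show ?thesis
        using on_branch[of "b r" "b r'"] b[of r] b[of r'] new r by (simp add: rd')
    qed
  qed
  moreover have "\<exists>q\<in>points T'. code_dist g (loc' q) u = 0" if u: "u \<in> {0..?t}" for u
  proof (cases "u \<le> ?l")
    case True
    have "\<exists>q\<in>points T. code_dist g (loc q) u = 0"
    proof (cases "u \<le> peak n")
      case False
      then show ?thesis
        using coded_upto_descent[OF C, of u] n descent[OF n, of _ u] True by simp
    next
      case True
      then show ?thesis using cover[of u] u by simp
    qed
    then obtain q where "q \<in> points T" "code_dist g (loc q) u = 0" by blast
    then show ?thesis using old[of q] points' by (intro bexI[of _ q]) simp_all
  next
    case False
    show ?thesis
    proof (cases "g u = g ?l")
      case True
      then have "code_dist g ?l u = 0" using on_branch[of ?l u] False u order by simp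
      then have "code_dist g (loc p) u = 0"
        using code_dist_cong(1)[OF cont _ _ _ p_low, of u] loc[OF pT] order u by simp
      then show ?thesis using old[OF pT] pT points' by (intro bexI[of _ p]) simp_all
    next
      case neq: False
      then have "0 < g u - g ?l" "g u - g ?l \<le> X (Suc n)"
        using ascent[OF n, of ?l u] ascent[OF n, of u ?t] False u X[OF n] by auto
      then have "(Suc n, g u - g ?l) \<in> points T'" "code_dist g (b (g u - g ?l)) u = 0"
        using on_branch[of "b (g u - g ?l)" u] b[of "g u - g ?l"] False u by (auto simp: points')
      then show ?thesis using new by (intro bexI[of _ "(Suc n, g u - g ?l)"]) simp_all
    qed
  qed
  moreover have "tip T' \<in> points T' \<and> code_dist g (loc' (tip T')) ?t = 0"
  proof (cases "X (Suc n) = 0")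
    case True
    then have "code_dist g ?l ?t = 0" using on_branch[of ?l ?t] X[OF n] order by simp
    then have "code_dist g (loc p) ?t = 0"
      using code_dist_cong(1)[OF cont _ _ _ p_low, of ?t] loc[OF pT] order by simp
    then show ?thesis using True old[OF pT] pT by (simp add: points' tip')
  next
    case False
    then show ?thesis
      using on_branch[of "b (X (Suc n))" ?t] b[of "X (Suc n)"] X0 X[OF n] new order
      by (simp add: points' tip')
  qed
  moreover have "origin T' \<in> points T' \<and> code_dist g 0 (loc' (origin T')) = 0"
    using o old[OF o(1)] by (simp add: origin' points')
  ultimately have "coded_upto (Suc n) T' loc'"
    unfolding coded_upto_def by blast
  then show ?thesis unfolding T'_def by blast
qed

text \<open>
  The geodesic from the root to the tip runs through the ancestors of \<open>peak n\<close>, that is, through the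
  last visits to the levels below \<open>g (peak n)\<close>.
\<close>

lemma grafting_point_exists:
  assumes C: "coded_upto n T loc" and n: "n < N"
  shows "\<exists>p\<in>geodesic (points T) (rdist T) (origin T) (tip T). rdist T p (tip T) = Y (Suc n)"
proof -
  have t: "0 \<le> peak n" using peak_nonneg n by simp
  have loc: "\<And>q. q \<in> points T \<Longrightarrow> 0 \<le> loc q"
    and rd: "\<And>q r. q \<in> points T \<Longrightarrow> r \<in> points T \<Longrightarrow> rdist T q r = code_dist g (loc q) (loc r)"
    and sep: "\<And>q r. q \<in> points T \<Longrightarrow> r \<in> points T \<Longrightarrow> rdist T q r = 0 \<Longrightarrow> q = r"
    and cover: "\<And>u. 0 \<le> u \<Longrightarrow> u \<le> peak n \<Longrightarrow> \<exists>q\<in>points T. code_dist g (loc q) u = 0"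
    and o: "origin T \<in> points T" "code_dist g 0 (loc (origin T)) = 0"
    and z: "tip T \<in> points T" "code_dist g (loc (tip T)) (peak n) = 0"
    using coded_uptoD[OF C] by blast+
  define D where "D = g (peak n)"
  \<comment> \<open>\<open>w r\<close> codes the ancestor of the tip at height \<open>r\<close>\<close>
  define w where "w r = (SOME u. 0 \<le> u \<and> u \<le> peak n \<and> g u = r \<and> (\<forall>v. u \<le> v \<longrightarrow> v \<le> peak n \<longrightarrow> r \<le> g v))" for r
  have w: "0 \<le> w r \<and> w r \<le> peak n \<and> g (w r) = r \<and> (\<forall>v. w r \<le> v \<longrightarrow> v \<le> peak n \<longrightarrow> r \<le> g v)"
    if r: "0 \<le> r" "r \<le> D" for r
  proof -
    have "continuous_on {0..peak n} g" by (rule continuous_on_subset[OF cont]) auto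
    then obtain u where "0 \<le> u" "u \<le> peak n" "g u = r" "\<And>v. u \<le> v \<Longrightarrow> v \<le> peak n \<Longrightarrow> r \<le> g v"
      by (rule last_visit[of 0 "peak n" g r]) (use t g_0 r in \<open>auto simp: D_def\<close>)
    then show ?thesis
      unfolding w_def
      by (intro someI_ex[of "\<lambda>u. 0 \<le> u \<and> u \<le> peak n \<and> g u = r \<and>
            (\<forall>v. u \<le> v \<longrightarrow> v \<le> peak n \<longrightarrow> r \<le> g v)"]) blast
  qed
  have w_dist: "code_dist g (w r) (w s) = \<bar>r - s\<bar>" if "0 \<le> r" "r \<le> D" "0 \<le> s" "s \<le> D" for r s
  proof -
    have *: "code_dist g (w r) (w s) = s - r" if "0 \<le> r" "r \<le> s" "s \<le> D" for r s
    proof -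
      have wr: "0 \<le> w r" "w r \<le> peak n" "g (w r) = r" "\<And>v. w r \<le> v \<Longrightarrow> v \<le> peak n \<Longrightarrow> r \<le> g v"
        using w[of r] that by auto
      have ws: "0 \<le> w s" "w s \<le> peak n" "g (w s) = s" "\<And>v. w s \<le> v \<Longrightarrow> v \<le> peak n \<Longrightarrow> s \<le> g v"
        using w[of s] that by auto
      have "g (w r) \<le> g v" if v: "v \<in> betw (w r) (w s)" for v
      proof (cases "w r \<le> v")
        case True
        then show ?thesis using wr ws v by auto
      next
        case False
        then have "s \<le> g v" using wr ws v by auto
        then show ?thesis using \<open>r \<le> s\<close> wr by simp
      qed
      then show ?thesis using code_dist_ancestor_iff[OF cont wr(1) ws(1)] wr(3) ws(3) by simp
    qed
    show ?thesis
      using *[of r s] *[of s r] that by (cases "r \<le> s") (auto simp: code_dist_commute)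
  qed
  define \<gamma> where "\<gamma> r = (SOME p. p \<in> points T \<and> code_dist g (loc p) (w r) = 0)" for r
  have \<gamma>: "\<gamma> r \<in> points T" "code_dist g (loc (\<gamma> r)) (w r) = 0" if "0 \<le> r" "r \<le> D" for r
  proof -
    have "\<exists>p. p \<in> points T \<and> code_dist g (loc p) (w r) = 0"
      using cover w[OF that] by blast
    then have "\<gamma> r \<in> points T \<and> code_dist g (loc (\<gamma> r)) (w r) = 0"
      unfolding \<gamma>_def by (rule someI_ex)
    then show "\<gamma> r \<in> points T" "code_dist g (loc (\<gamma> r)) (w r) = 0" by auto
  qed
  have to_time: "rdist T (\<gamma> r) q = code_dist g (w r) u"
    if r: "0 \<le> r" "r \<le> D" and q: "q \<in> points T" "code_dist g (loc q) u = 0" "0 \<le> u" for r q u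
  proof -
    have "code_dist g (loc (\<gamma> r)) (loc q) = code_dist g (w r) (loc q)"
      by (rule code_dist_cong(1)[OF cont]) (use \<gamma>[OF r] w[OF r] loc q in auto)
    also have "\<dots> = code_dist g (w r) u"
      by (rule code_dist_cong(2)[OF cont]) (use w[OF r] loc q in auto)
    finally show ?thesis using rd[OF \<gamma>(1)[OF r] q(1)] by simp
  qed
  have D0: "0 \<le> D" using nonneg[OF t] by (simp add: D_def)
  have \<gamma>_dist: "rdist T (\<gamma> r) (\<gamma> s) = \<bar>r - s\<bar>" if "0 \<le> r" "r \<le> D" "0 \<le> s" "s \<le> D" for r s
    using to_time[of r "\<gamma> s" "w s"] \<gamma>[of s] w[of s] w_dist[of r s] that by simp
  have "rdist T (\<gamma> 0) (origin T) = code_dist g (w 0) 0"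
    using o D0 by (intro to_time) (auto simp: code_dist_commute)
  also have "\<dots> = 0"
    using code_dist_root[OF cont nonneg g_0, of "w 0"] w[of 0] D0 by (simp add: code_dist_commute)
  finally have \<gamma>0: "\<gamma> 0 = origin T" using sep \<gamma>(1)[of 0] o(1) D0 by simp
  have tip_dist: "rdist T (\<gamma> r) (tip T) = D - r" if "0 \<le> r" "r \<le> D" for r
  proof -
    have "code_dist g (w r) (peak n) = D - r"
      using code_dist_ancestor_iff[OF cont, of "w r" "peak n"] w[OF that] t by (auto simp: D_def)
    then show ?thesis using to_time[OF that z t] by simp
  qed
  then have \<gamma>D: "\<gamma> D = tip T" using sep[of "\<gamma> D" "tip T"] \<gamma>(1)[of D] z(1) D0 by simp
  have len: "rdist T (origin T) (tip T) = D" using tip_dist[of 0] \<gamma>0 D0 by simp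
  have "\<gamma> (g (valley (Suc n))) \<in> geodesic (points T) (rdist T) (origin T) (tip T)"
    unfolding geodesic_def len
    using \<gamma>(1) \<gamma>0 \<gamma>D \<gamma>_dist valley_le[OF n] nonneg[of "valley (Suc n)"] ordered[OF n] t
    by (auto simp: D_def intro!: exI[of _ \<gamma>])
  moreover have "rdist T (\<gamma> (g (valley (Suc n)))) (tip T) = Y (Suc n)"
    using tip_dist valley_le[OF n] nonneg[of "valley (Suc n)"] ordered[OF n] t Y[OF n] by (simp add: D_def)
  ultimately show ?thesis by blast
qed

lemma after_step_coded:
  assumes "after_step (enat N) X Y n T"
  shows "1 \<le> n \<and> n \<le> N \<and> (\<exists>loc. coded_upto n T loc)"
  using assms
proof induction
  case step_1
  then show ?case using coded_upto_single_branch N_pos by simp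
next
  case (step_n n T p)
  then show ?case using coded_upto_graft[of "n - 1" T _ p] by auto
qed

lemma after_step_exists:
  assumes "1 \<le> n" "n \<le> N"
  shows "\<exists>T. after_step (enat N) X Y n T"
  using assms
proof (induction n rule: nat_induct_at_least)
  case base
  then show ?case using after_step.step_1 X_nonneg[of 0] N_pos by auto
next
  case (Suc n)
  then obtain T loc where T: "after_step (enat N) X Y n T" "coded_upto n T loc"
    using after_step_coded by force
  then obtain p where "p \<in> geodesic (points T) (rdist T) (origin T) (tip T)" "rdist T p (tip T) = Y (Suc n)"
    using grafting_point_exists Suc by force
  then have "after_step (enat N) X Y (Suc n) (graft (Suc n) p (X (Suc n)) T)"
    using T(1) Suc X_nonneg[of n] by (intro after_step.step_n) auto
  then show ?case by blast
qed

lemma generated_tree_exists: "\<exists>T. generated_tree (enat N) X Y T"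
  using after_step_exists[OF N_pos] unfolding generated_tree_def by force

text \<open>After the last peak no new point appears, so the generated tree is the whole tree of \<open>g\<close>.\<close>

lemma generated_tree_coded:
  assumes "generated_tree (enat N) X Y T"
  obtains loc where "\<And>p. p \<in> points T \<Longrightarrow> 0 \<le> loc p"
    "\<And>p q. p \<in> points T \<Longrightarrow> q \<in> points T \<Longrightarrow> rdist T p q = code_dist g (loc p) (loc q)"
    "\<And>p q. p \<in> points T \<Longrightarrow> q \<in> points T \<Longrightarrow> rdist T p q = 0 \<Longrightarrow> p = q"
    "\<And>u. 0 \<le> u \<Longrightarrow> \<exists>p\<in>points T. code_dist g (loc p) u = 0"
    "origin T \<in> points T" "code_dist g 0 (loc (origin T)) = 0"
proof -
  obtain n where "after_step (enat N) X Y n T" "N < n + 1"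
    using assms unfolding generated_tree_def by auto
  then obtain loc where C: "coded_upto N T loc"
    using after_step_coded[of n T] by (metis Suc_eq_plus1 le_antisym less_Suc_eq_le)
  have "\<exists>p\<in>points T. code_dist g (loc p) u = 0" if "0 \<le> u" for u
  proof (cases "u \<le> peak N")
    case True
    then show ?thesis using coded_uptoD(4)[OF C that] by simp
  next
    case False
    then show ?thesis using coded_upto_descent[OF C, of u] final_descent[of _ u] by simp
  qed
  then show thesis
    using coded_uptoD[OF C] by (intro that[of loc]) blast+
qed

end

section \<open>The successive peaks and valleys of the cut function\<close>

lemma hit_after_infty: "hit_after F y \<infinity> = \<infinity>"
  by (simp add: hit_after_def top_ereal_def)

lemma hit_after_cases:
  assumes F: "continuous_on {0..} F" and a: "0 \<le> a" "F a \<noteq> y"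
  obtains (never) "hit_after F y (ereal a) = \<infinity>" "\<And>u. a < u \<Longrightarrow> F u \<noteq> y"
  | (hit) b where "hit_after F y (ereal a) = ereal b" "a < b" "F b = y"
      "\<And>u. a < u \<Longrightarrow> u < b \<Longrightarrow> F u \<noteq> y"
proof -
  define S where "S = {u. a < u \<and> F u = y}"
  have hit_eq: "hit_after F y (ereal a) = Inf (ereal ` S)"
    unfolding hit_after_def S_def using a(1) by (intro arg_cong[where f = Inf] arg_cong2[where f = image]) auto
  show thesis
  proof (cases "S = {}")
    case True
    then have "hit_after F y (ereal a) = \<infinity>" using hit_eq by (simp add: top_ereal_def)
    moreover have "F u \<noteq> y" if "a < u" for u using True that by (auto simp: S_def)
    ultimately show thesis by (rule never)
  next
    case False
    have bdd: "bdd_below S" by (auto simp: S_def intro!: bdd_belowI[of _ a])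
    have "closed {u\<in>{a..}. F u = y}"
      by (intro continuous_closed_preimage_constant continuous_on_subset[OF F]) (use a in auto)
    moreover have "S \<subseteq> {u\<in>{a..}. F u = y}" by (auto simp: S_def)
    ultimately have "closure S \<subseteq> {u\<in>{a..}. F u = y}" by (rule closure_minimal[rotated])
    then have "Inf S \<in> {u\<in>{a..}. F u = y}"
      using closure_contains_Inf[OF False bdd] by blast
    then have "a \<le> Inf S" "F (Inf S) = y" by auto
    moreover from this a(2) have "Inf S \<noteq> a" by auto
    moreover have "F u \<noteq> y" if "a < u" "u < Inf S" for u
      using cInf_lower[OF _ bdd, of u] that by (auto simp: S_def)
    moreover have "hit_after F y (ereal a) = ereal (Inf S)"
      using ereal_Inf'[OF bdd False] hit_eq by simp
    ultimately show thesis using hit[of "Inf S"] by simp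
  qed
qed

context cut
begin

lemma L_eventually_0: "\<exists>B\<ge>0. \<forall>t\<ge>B. L t = 0"
proof -
  obtain B where B: "0 \<le> B" "\<And>t. B \<le> t \<Longrightarrow> f t = 0" using C0_plusD(4)[OF f] by blast
  have "L t = 0" if "B \<le> t" for t
    using B(2)[OF that] f_eq[of t] g_nonneg[of t] L_range[of t] B(1) that by simp
  then show ?thesis using B(1) by blast
qed

text \<open>
  After a zero of \<open>L\<close>, either the level \<open>h\<close> is never reached again, or \<open>L\<close> reaches it and, as it
  ends at \<open>0\<close>, returns to \<open>0\<close>.
\<close>

lemma excursion_cases:
  assumes a: "0 \<le> a" "L a = 0"
  obtains (last) "hit_after L 0 (hit_after L h (ereal a)) = \<infinity>" "\<And>u. a < u \<Longrightarrow> L u \<noteq> h"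
  | (excursion) b c where "hit_after L 0 (hit_after L h (ereal a)) = ereal c" "a < b" "b < c"
      "L b = h" "L c = 0" "\<And>u. a < u \<Longrightarrow> u < b \<Longrightarrow> L u \<noteq> h" "\<And>u. b < u \<Longrightarrow> u < c \<Longrightarrow> L u \<noteq> 0"
proof -
  have "L a \<noteq> h" using a(2) h_pos by simp
  with cont_L a(1) show thesis
  proof (cases rule: hit_after_cases)
    case never
    then show thesis using last by (simp add: hit_after_infty)
  next
    case (hit b)
    have "0 \<le> b" "L b \<noteq> 0" using hit a h_pos by simp_all
    with cont_L show thesis
    proof (cases rule: hit_after_cases)
      case never
      obtain B where B: "\<And>t. B \<le> t \<Longrightarrow> L t = 0" using L_eventually_0 by blast
      then have "L (max B (b + 1)) = 0" by simp
      moreover have "L (max B (b + 1)) \<noteq> 0" by (rule never(2)) simp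
      ultimately show thesis by contradiction
    next
      case (hit c)
      with \<open>hit_after L h (ereal a) = ereal b\<close> show thesis
        using excursion[of c b] \<open>a < b\<close> \<open>L b = h\<close> \<open>\<And>u. a < u \<Longrightarrow> u < b \<Longrightarrow> L u \<noteq> h\<close> by simp
    qed
  qed
qed

definition peak :: "nat \<Rightarrow> real" where "peak n = real_of_ereal (t_time h f n)"
definition valley :: "nat \<Rightarrow> real" where "valley n = real_of_ereal (s_time h f n)"

lemma t_time_finite:
  "t_time h f n < \<infinity> \<Longrightarrow> t_time h f n = ereal (peak n) \<and> 0 \<le> peak n \<and> L (peak n) = 0"
proof (induction n)
  case 0
  then show ?case by (simp add: peak_def L_0 zero_ereal_def)
next
  case (Suc n)
  have "t_time h f n < \<infinity>"
    using Suc.prems hit_after_infty by (cases "t_time h f n = \<infinity>") auto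
  then have n: "t_time h f n = ereal (peak n)" "0 \<le> peak n" "L (peak n) = 0"
    using Suc.IH by auto
  from n(2,3) show ?case
  proof (cases rule: excursion_cases)
    case last
    then show ?thesis using Suc.prems n(1) by simp
  next
    case (excursion b c)
    then show ?thesis using n by (simp add: peak_def[of "Suc n"])
  qed
qed

lemma t_time_finite_pred: "t_time h f (Suc n) < \<infinity> \<Longrightarrow> t_time h f n < \<infinity>"
  using hit_after_infty by (cases "t_time h f n = \<infinity>") auto

lemma excursion_between_peaks:
  assumes "t_time h f (Suc n) < \<infinity>"
  obtains b where "peak n < b" "b < peak (Suc n)" "L b = h"
    "\<And>u. peak n < u \<Longrightarrow> u < b \<Longrightarrow> L u \<noteq> h" "\<And>u. b < u \<Longrightarrow> u < peak (Suc n) \<Longrightarrow> L u \<noteq> 0"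
proof -
  have n: "t_time h f n = ereal (peak n)" "0 \<le> peak n" "L (peak n) = 0"
    using t_time_finite t_time_finite_pred[OF assms] by auto
  from n(2,3) show thesis
  proof (cases rule: excursion_cases)
    case last
    then show ?thesis using assms n(1) by simp
  next
    case (excursion b c)
    then have "peak (Suc n) = c" using n(1) by (simp add: peak_def[of "Suc n"])
    then show thesis using excursion that by blast
  qed
qed

text \<open>
  Infinitely many crossings of \<open>[0,h]\<close> would accumulate inside a compact interval, where \<open>L\<close> would
  be discontinuous.
\<close>

lemma finitely_many_peaks: "\<exists>n. t_time h f n = \<infinity>"
proof (rule ccontr)
  assume "\<nexists>n. t_time h f n = \<infinity>"
  then have fin: "t_time h f n < \<infinity>" for n by (simp add: less_top[symmetric] top_ereal_def)
  have "\<exists>b. peak n < b \<and> b < peak (Suc n) \<and> L b = h" for n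
    using excursion_between_peaks[OF fin[of "Suc n"]] by metis
  then obtain b where b: "peak n < b n" "b n < peak (Suc n)" "L (b n) = h" for n by metis
  have nonneg: "0 \<le> peak n" and zero: "L (peak n) = 0" for n using t_time_finite[OF fin] by auto
  obtain B where B: "\<And>t. B \<le> t \<Longrightarrow> L t = 0" using L_eventually_0 by blast
  have "b n < B" for n using B[of "b n"] b(3)[of n] h_pos by (cases "b n < B") auto
  then have "peak n \<le> B" for n using b(1)[of n] by (meson less_imp_le less_trans)
  moreover have "incseq peak" using b by (intro incseq_SucI) (meson less_imp_le less_trans)
  ultimately obtain l where l: "peak \<longlonglongrightarrow> l" by (metis incseq_convergent)
  have "0 \<le> l" using nonneg by (intro LIMSEQ_le_const[OF l]) auto
  have "b \<longlonglongrightarrow> l"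
    by (rule real_tendsto_sandwich[OF _ _ l LIMSEQ_Suc[OF l]]) (use b in \<open>auto intro!: always_eventually less_imp_le\<close>)
  moreover have "0 \<le> b n" for n using b(1)[of n] nonneg[of n] by linarith
  ultimately have "(\<lambda>n. L (b n)) \<longlonglongrightarrow> L l"
    using \<open>0 \<le> l\<close> by (intro continuous_on_tendsto_compose[OF cont_L]) auto
  moreover have "(\<lambda>n. L (peak n)) \<longlonglongrightarrow> L l"
    using \<open>0 \<le> l\<close> nonneg by (intro continuous_on_tendsto_compose[OF cont_L l]) auto
  ultimately have "h = 0"
    by (simp add: b(3) zero LIMSEQ_const_iff)
  then show False using h_pos by simp
qed

lemma t_time_finite_iff: "\<exists>N. \<forall>n. t_time h f n < \<infinity> \<longleftrightarrow> n \<le> N"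
proof -
  define M where "M = (LEAST n. t_time h f n = \<infinity>)"
  have M: "t_time h f M = \<infinity>"
    unfolding M_def using finitely_many_peaks by (auto intro: LeastI)
  have "t_time h f n = \<infinity>" if "M \<le> n" for n
    using that
  proof (induction n rule: dec_induct)
    case (step n)
    then show ?case by (simp add: hit_after_infty)
  qed (rule M)
  moreover have "t_time h f n < \<infinity>" if "n < M" for n
    using not_less_Least[of n "\<lambda>n. t_time h f n = \<infinity>"] that
    by (simp add: M_def less_top[symmetric] top_ereal_def)
  moreover have "M \<noteq> 0" using M by (cases M) auto
  ultimately show ?thesis
    by (intro exI[of _ "M - 1"]) (metis Suc_pred' bot_nat_0.not_eq_extremum less_Suc_eq_le less_irrefl not_le)
qed

lemma s_time_finite:
  assumes "t_time h f (Suc n) < \<infinity>"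
  shows "peak n \<le> valley (Suc n)" "valley (Suc n) \<le> peak (Suc n)"
    "\<And>u. peak n < u \<Longrightarrow> u < valley (Suc n) \<Longrightarrow> L u \<noteq> h"
    "\<And>u. valley (Suc n) < u \<Longrightarrow> u < peak (Suc n) \<Longrightarrow> L u \<noteq> 0"
proof -
  have n: "t_time h f n = ereal (peak n)" "0 \<le> peak n" "L (peak n) = 0"
    and Suc_n: "t_time h f (Suc n) = ereal (peak (Suc n))"
    using t_time_finite t_time_finite_pred[OF assms] assms by auto
  obtain b where b: "peak n < b" "b < peak (Suc n)" "L b = h"
    "\<And>u. peak n < u \<Longrightarrow> u < b \<Longrightarrow> L u \<noteq> h" "\<And>u. b < u \<Longrightarrow> u < peak (Suc n) \<Longrightarrow> L u \<noteq> 0"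
    using excursion_between_peaks[OF assms] by blast
  have "continuous_on {peak n..b} L"
    using n(2) by (intro continuous_on_subset[OF cont_L]) auto
  then obtain s where s: "peak n \<le> s" "s \<le> b" "L s = 0" "\<And>v. s < v \<Longrightarrow> v \<le> b \<Longrightarrow> L v \<noteq> 0"
    by (rule last_time[of "peak n" b L "peak n" 0]) (use n b in auto)
  have after: "L u \<noteq> 0" if "s < u" "u < peak (Suc n)" for u
    using s(4)[of u] b(5)[of u] that by (cases "u \<le> b") auto
  define S where "S = {u. t_time h f (Suc n - 1) \<le> ereal u \<and> ereal u < t_time h f (Suc n) \<and> L u = 0}"
  have S: "S = {u. peak n \<le> u \<and> u < peak (Suc n) \<and> L u = 0}"
    unfolding S_def Suc_n by (simp add: n(1))
  have "s \<in> S" using s b by (simp add: S)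
  moreover have "u \<le> s" if "u \<in> S" for u
    using after[of u] that by (cases "u \<le> s") (auto simp: S)
  ultimately have "Sup (ereal ` S) = ereal s"
    by (intro Sup_eqI) auto
  moreover have "s_time h f (Suc n) = Sup (ereal ` S)"
    using \<open>s \<in> S\<close> unfolding s_time_def S_def[symmetric] Let_def by auto
  ultimately have "valley (Suc n) = s" by (simp add: valley_def)
  then show "peak n \<le> valley (Suc n)" "valley (Suc n) \<le> peak (Suc n)"
    "\<And>u. peak n < u \<Longrightarrow> u < valley (Suc n) \<Longrightarrow> L u \<noteq> h"
    "\<And>u. valley (Suc n) < u \<Longrightarrow> u < peak (Suc n) \<Longrightarrow> L u \<noteq> 0"
    using s b after by auto
qed

text \<open>If \<open>L\<close> never reached \<open>h\<close>, then \<open>g\<close> would be \<open>0\<close> and \<open>f = L\<close> would stay below \<open>h\<close>.\<close>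

lemma first_peak_finite:
  assumes "trimming h f \<noteq> {}"
  shows "t_time h f 1 < \<infinity>"
proof -
  obtain r where r: "0 \<le> r" "tree_proj f r \<in> trimming h f"
    using assms by (auto simp: trimming_def coded_tree_eq)
  then obtain v where v: "0 \<le> v" "f r + h \<le> f v"
    using proj_in_trimming_iff[OF f _ h_pos] by blast
  show ?thesis
  proof (cases rule: excursion_cases[OF order_refl L_0])
    case 1
    then have "g v \<le> g 0" using v by (intro g_down_if_L_less) auto
    then have "L v = f v" using g_nonneg[OF v(1)] g_0 f_eq[of v] by simp
    then have "L v = h" using v L_range[OF v(1)] f_nonneg[OF r(1)] by simp
    then show ?thesis using 1(2)[of v] v(1) L_0 h_pos by (cases "v = 0") auto
  next
    case (2 b c)
    then show ?thesis by (simp add: zero_ereal_def)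
  qed
qed

lemma cut_zigzag:
  assumes "trimming h f \<noteq> {}"
  shows "\<exists>N. N_count h f = enat N \<and> zigzag g N peak valley (X_len h f) (Y_len h f)"
proof -
  obtain N where N: "\<And>n. t_time h f n < \<infinity> \<longleftrightarrow> n \<le> N" using t_time_finite_iff by blast
  have "N_count h f = enat N"
    unfolding N_count_def N by (intro Sup_eqI) auto
  moreover have "zigzag g N peak valley (X_len h f) (Y_len h f)"
  proof
    show "continuous_on {0..} g" by (rule cont_g)
    show "0 \<le> g t" if "0 \<le> t" for t using g_nonneg[OF that] .
    show "g 0 = 0" by (rule g_0)
    show "1 \<le> N" using first_peak_finite[OF assms] N by blast
    show "peak 0 = 0" by (simp add: peak_def)
    fix n assume "n < N"
    then have fin: "t_time h f (Suc n) < \<infinity>" using N[of "Suc n"] by simp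
    have peak: "0 \<le> peak n" using t_time_finite[OF t_time_finite_pred[OF fin]] by simp
    note s = s_time_finite[OF fin]
    show "peak n \<le> valley (Suc n) \<and> valley (Suc n) \<le> peak (Suc n)" using s by simp
    show "g b \<le> g a" if "peak n \<le> a" "a \<le> b" "b \<le> valley (Suc n)" for a b
      using s(3) peak that by (intro g_down_if_L_less) auto
    show "g a \<le> g b" if "valley (Suc n) \<le> a" "a \<le> b" "b \<le> peak (Suc n)" for a b
      using s(1,4) peak that by (intro g_up_if_L_pos) auto
    show "X_len h f (Suc n) = g (peak (Suc n)) - g (valley (Suc n))"
      by (simp add: X_len_def peak_def valley_def)
    show "Y_len h f (Suc n) = g (peak n) - g (valley (Suc n))"
      by (simp add: Y_len_def peak_def valley_def)
  next
    fix a b assume ab: "peak N \<le> a" "a \<le> b"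
    have peak: "t_time h f N = ereal (peak N)" "0 \<le> peak N" "L (peak N) = 0"
      using t_time_finite N[of N] by auto
    from peak(2,3) have "L u \<noteq> h" if "peak N < u" for u
    proof (cases rule: excursion_cases)
      case last
      then show ?thesis using that by blast
    next
      case (excursion b c)
      then have "t_time h f (Suc N) < \<infinity>" using peak(1) by simp
      then show ?thesis using N[of "Suc N"] by simp
    qed
    then show "g b \<le> g a" using ab peak(2) by (intro g_down_if_L_less) auto
  qed
  ultimately show ?thesis by blast
qed

end

section \<open>The generated tree is the trimmed tree\<close>

theorem proposition1p3:
  fixes h :: real and f :: "real \<Rightarrow> real"
  assumes "h > 0"
    and "f \<in> C0_plus"
    and "trimming h f \<noteq> {}"
  shows "(\<exists>T. generated_tree (N_count h f) (X_len h f) (Y_len h f) T) \<and>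
    (\<forall>T. generated_tree (N_count h f) (X_len h f) (Y_len h f) T \<longrightarrow>
       root_isometric (trimming h f) (tree_dist f) (tree_root f)
         (points T) (rdist T) (origin T))"
proof -
  interpret cut h f using assms by unfold_locales
  obtain N where N: "N_count h f = enat N" "zigzag g N peak valley (X_len h f) (Y_len h f)"
    using cut_zigzag[OF assms(3)] by blast
  interpret zigzag g N peak valley "X_len h f" "Y_len h f" by (rule N(2))
  have "root_isometric (trimming h f) (tree_dist f) (tree_root f) (points T) (rdist T) (origin T)"
    if gen: "generated_tree (enat N) (X_len h f) (Y_len h f) T" for T
  proof -
    obtain loc where loc: "\<And>p. p \<in> points T \<Longrightarrow> 0 \<le> loc p"
      and dist: "\<And>p q. p \<in> points T \<Longrightarrow> q \<in> points T \<Longrightarrow> rdist T p q = code_dist g (loc p) (loc q)"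
      and sep: "\<And>p q. p \<in> points T \<Longrightarrow> q \<in> points T \<Longrightarrow> rdist T p q = 0 \<Longrightarrow> p = q"
      and cover: "\<And>u. 0 \<le> u \<Longrightarrow> \<exists>p\<in>points T. code_dist g (loc p) u = 0"
      and origin: "origin T \<in> points T" "code_dist g 0 (loc (origin T)) = 0"
      by (rule generated_tree_coded[OF gen]) blast
    define \<psi> where "\<psi> p = node (loc p)" for p
    have iso: "tree_dist f (\<psi> p) (\<psi> q) = rdist T p q" if "p \<in> points T" "q \<in> points T" for p q
      using tree_dist_node[OF loc loc] dist that by (simp add: \<psi>_def)
    have "inj_on \<psi> (points T)"
      using node_eq_iff[OF loc loc] dist sep unfolding inj_on_def \<psi>_def by metis
    moreover have "\<psi> ` points T = trimming h f"
      unfolding trimming_eq_nodes[OF assms(3)]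
    proof
      show "\<psi> ` points T \<subseteq> node ` {0..}" using loc by (auto simp: \<psi>_def)
      show "node ` {0..} \<subseteq> \<psi> ` points T"
      proof
        fix x assume "x \<in> node ` {0..}"
        then obtain u where u: "0 \<le> u" "x = node u" by auto
        then obtain p where p: "p \<in> points T" "code_dist g (loc p) u = 0" using cover by blast
        then have "x = \<psi> p" using node_eq_iff[OF loc[OF p(1)] u(1)] u(2) by (simp add: \<psi>_def)
        then show "x \<in> \<psi> ` points T" using p(1) by blast
      qed
    qed
    ultimately have bij: "bij_betw \<psi> (points T) (trimming h f)" by (simp add: bij_betw_def)
    have root: "\<psi> (origin T) = tree_root f"
      using node_eq_iff[OF order_refl loc[OF origin(1)]] origin(2) node_0 by (simp add: \<psi>_def)
    define \<phi> where "\<phi> = inv_into (points T) \<psi>"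
    have \<phi>: "bij_betw \<phi> (trimming h f) (points T)"
      unfolding \<phi>_def using bij by (rule bij_betw_inv_into)
    have \<psi>\<phi>: "\<psi> (\<phi> x) = x" if "x \<in> trimming h f" for x
      unfolding \<phi>_def using bij_betw_inv_into_right[OF bij that] .
    have "rdist T (\<phi> x) (\<phi> y) = tree_dist f x y" if "x \<in> trimming h f" "y \<in> trimming h f" for x y
      using iso[of "\<phi> x" "\<phi> y"] \<psi>\<phi> that bij_betwE[OF \<phi>] by simp
    moreover have "\<phi> (tree_root f) = origin T"
      unfolding \<phi>_def root[symmetric] using bij_betw_inv_into_left[OF bij origin(1)] .
    moreover have "tree_root f \<in> trimming h f"
      using bij_betwE[OF bij] origin(1) root by metis
    ultimately show ?thesis
      unfolding root_isometric_def using \<phi> origin(1) by blast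
  qed
  then show ?thesis using generated_tree_exists unfolding N(1) by blast
qed

end
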